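(* Suppose that $H$ is a parallel poly-pushdown ($\mathcal P$) group, $n$ is a positive integer and $\varphi:H\to \mathrm{Aut}(\mathbb Z^n)$ is a homomorphism. Then the semidirect product $\mathbb Z^n\rtimes_\varphi H$ is a $\mathcal P$ group.
   Context: **Languages.** For a finite alphabet $A$, $A^*$ is the free monoid on $A$ (words), $\epsilon$ is the empty word, and a language is a subset of $A^*$. **Deterministic pushdown automata.** A deterministic pushdown automaton is a 7-tuple $M=(S,A,B,\tau,s_0,Z_0,Y)$ with $S$ a finite set of states, $A$ a finite input alphabet, $B$ a finite stack alphabet, $s_0\in S$ the start state, $Z_0\in B$ the start symbol, $Y\subseteq S$ the final states, and $\tau:\Sigma\to S\times B^*$ a map with $\Sigma\subseteq (A\cup\{\epsilon\})\times B\times S$ such that for every $(b,s)\in B\times S$ either $(\epsilon,b,s)\in\Sigma$ and $(a,b,s)\notin\Sigma$ for all $a\in A$, or $(\epsilon,b,s)\notin\Sigma$ and $(a,b,s)\in\Sigma$ for all $a\in A$. An instantaneous description is a triple $(u,z,s)\in A^*\times B^*\times S$ (unread input, stack with top at the right end, state). $M$ makes the transition $(av,yb,s)\to(v,y\alpha,t)$ if $a\in A\cup\{\epsilon\}$, $b\in B$, $(a,b,s)\in \Sigma$ and $\tau(a,b,s)=(t,\alpha)$; $\to^*$ is the reflexive transitive closure. $M$ accepts $w$ by final state if $(w,Z_0,s_0)\to^*(\epsilon,z,s)$ for some $z\in B^*$, $s\in Y$; it accepts $w$ by empty stack if $(w,Z_0,s_0)\to^*(\epsilon,\epsilon,s)$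 for some $s\in S$. A language is the language of a deterministic pushdown automaton if it is the set of words accepted by some such $M$ in either one of these two modes. **$\mathcal P$ languages.** $L\subseteq A^*$ is parallel poly-pushdown ($\mathcal P$) if it is an intersection of finitely many languages over $A$ of deterministic pushdown automata. **Two-tape version.** Let $\$$ be a symbol not in $A$, and let $(A\cup\{\$\})^\sharp$, $(A\cup\{\$\})^\flat$ be two disjoint copies of $A\cup\{\$\}$, with induced maps on words $u\mapsto u^\sharp$, $v\mapsto v^\flat$. A shuffle $\sigma(u,v)$ of words $u,v$ is a word $u_1^\sharp v_1^\flat\cdots u_k^\sharp v_k^\flat$ with $u=u_1\cdots u_k$, $v=v_1\cdots v_k$, $u_i\ne\epsilon$ for $i>1$, $v_j\neq\epsilon$ for $j<k$. An asynchronous two-tape pushdown automaton over $A$ is a deterministic pushdown automaton $T$ with input alphabet $(A\cup\{\$\})^\sharp\sqcup (A\cup\{\$\})^\flat$ whose states are partitioned into two sets $S_\sharp,S_\flat$. A pair $(u,v)\in A^*\times A^*$ is accepted by $T$ if some shuffle $\sigma(u\$,v\$)$ is accepted by $T$ and, while reading it, $T$ reads letters of $(A\cup\{\$\})^\sharp$ only in states of $S_\sharp$ and letters of $(A\cup\{\$\})^\flat$ only in states of $S_\flat$. The language of $T$ is the set of accepted pairs. A subset of $A^*\times A^*$ is AT$\mathcal P$ (asynchronous two-tape parallel poly-pushdown) if it is the intersection of the languages of finitely many asynchronous two-tape pushdown automata over $A$. **$\mathcal P$ groups.** Let $G$ be a group and $A$ a finite set with a map $A\to G$ such that the induced monoid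 homomorphism $A^*\to G$, $w\mapsto\overline w$, is surjective. A language $L\subseteq A^*$ is a parallel poly-pushdown structure for $G$ if (1) $w\mapsto \overline w$ restricts to a bijection $L\to G$; (2) $L$ is $\mathcal P$; (3) for each $a\in A$ the set $\{(w,w')\in L\times L: \overline{w'}=\overline{wa}\}$ is AT$\mathcal P$. $G$ is parallel poly-pushdown (a $\mathcal P$ group) if it has such a structure for some such $A$. *)

theory Defs
  imports "HOL-Algebra.Algebra"
begin

section \<open>Deterministic pushdown automata\<close>

text \<open>
  The partial map \<open>\<tau> : \<Sigma> \<rightarrow> S \<times> B\<^sup>*\<close> is an option-valued function, so that \<open>\<Sigma>\<close> is
  the set of arguments at which it is not \<open>None\<close>; its first argument \<open>None\<close> stands for \<open>\<epsilon>\<close>.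
\<close>

record ('a, 'b, 's) dpda =
  states :: "'s set"
  inputs :: "'a set"
  stack_syms :: "'b set"
  trans :: "'a option \<Rightarrow> 'b \<Rightarrow> 's \<Rightarrow> ('s \<times> 'b list) option"
  start_state :: 's
  start_sym :: 'b
  final_states :: "'s set"

definition is_dpda :: "('a, 'b, 's, 'm) dpda_scheme \<Rightarrow> bool" where
  "is_dpda M \<longleftrightarrow>
     finite (states M) \<and> finite (inputs M) \<and> finite (stack_syms M) \<and>
     start_state M \<in> states M \<and> start_sym M \<in> stack_syms M \<and> final_states M \<subseteq> states M \<and>
     (\<forall>x b s t \<alpha>. trans M x b s = Some (t, \<alpha>) \<longrightarrow>
        x \<in> insert None (Some ` inputs M) \<and> b \<in> stack_syms M \<and> s \<in> states M \<and>
        t \<in> states M \<and> \<alpha> \<in> lists (stack_syms M)) \<and>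
     (\<forall>b\<in>stack_syms M. \<forall>s\<in>states M.
        (trans M None b s \<noteq> None \<and> (\<forall>a\<in>inputs M. trans M (Some a) b s = None)) \<or>
        (trans M None b s = None \<and> (\<forall>a\<in>inputs M. trans M (Some a) b s \<noteq> None)))"

text \<open>
  Instantaneous descriptions are triples (unread input, stack, state); the top of the stack is the
  last element of the list.
\<close>

type_synonym ('a, 'b, 's) config = "'a list \<times> 'b list \<times> 's"

inductive dpda_step ::
  "('a, 'b, 's, 'm) dpda_scheme \<Rightarrow> ('a, 'b, 's) config \<Rightarrow> ('a, 'b, 's) config \<Rightarrow> bool"
  for M where
  read: "trans M (Some a) b s = Some (t, \<alpha>) \<Longrightarrow> dpda_step M (a # v, y @ [b], s) (v, y @ \<alpha>, t)"
| silent: "trans M None b s = Some (t, \<alpha>) \<Longrightarrow> dpda_step M (v, y @ [b], s) (v, y @ \<alpha>, t)"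

datatype acceptance_mode = Final_State | Empty_Stack

fun accepting ::
  "('a, 'b, 's, 'm) dpda_scheme \<Rightarrow> acceptance_mode \<Rightarrow> ('a, 'b, 's) config \<Rightarrow> bool" where
  "accepting M Final_State (u, z, s) \<longleftrightarrow> u = [] \<and> s \<in> final_states M"
| "accepting M Empty_Stack (u, z, s) \<longleftrightarrow> u = [] \<and> z = []"

definition initial_config :: "('a, 'b, 's, 'm) dpda_scheme \<Rightarrow> 'a list \<Rightarrow> ('a, 'b, 's) config" where
  "initial_config M w = (w, [start_sym M], start_state M)"

definition dpda_lang :: "('a, 'b, 's, 'm) dpda_scheme \<Rightarrow> acceptance_mode \<Rightarrow> 'a list set" where
  "dpda_lang M m =
     {w \<in> lists (inputs M). \<exists>c. (dpda_step M)\<^sup>*\<^sup>* (initial_config M w) c \<and> accepting M m c}"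

text \<open>
  Existential quantification over automata needs fixed types of states and of stack symbols.  Both
  sets are finite, so up to renaming they may be taken to be sets of natural numbers.
\<close>

definition is_dpda_language :: "'a set \<Rightarrow> 'a list set \<Rightarrow> bool" where
  "is_dpda_language A L \<longleftrightarrow>
     (\<exists>(M :: ('a, nat, nat) dpda) m. is_dpda M \<and> inputs M = A \<and> L = dpda_lang M m)"

text \<open>
  The intersected family is required to be nonempty because \<open>\<Inter> {}\<close> is \<open>UNIV\<close> rather than \<open>A\<^sup>*\<close>;
  the language \<open>A\<^sup>*\<close> itself is the language of a deterministic pushdown automaton.
\<close>

definition parallel_poly_pushdown :: "'a set \<Rightarrow> 'a list set \<Rightarrow> bool" where
  "parallel_poly_pushdown A L \<longleftrightarrow>
     (\<exists>F. finite F \<and> F \<noteq> {} \<and> (\<forall>K\<in>F. is_dpda_language A K) \<and> L = \<Inter> F)"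

section \<open>Asynchronous two-tape automata\<close>

text \<open>
  \<open>A \<union> {$}\<close> is represented by \<open>'a option\<close> with \<open>None\<close> for \<open>$\<close>, and its copies \<open>\<sharp>\<close> and \<open>\<flat>\<close> by the
  summands \<open>Inl\<close> and \<open>Inr\<close>.
\<close>

type_synonym 'a tape_letter = "'a option + 'a option"

definition tape_alphabet :: "'a set \<Rightarrow> 'a tape_letter set" where
  "tape_alphabet A = insert None (Some ` A) <+> insert None (Some ` A)"

definition end_marked :: "'a list \<Rightarrow> 'a option list" where
  "end_marked u = map Some u @ [None]"

text \<open>The list \<open>ps\<close> consists of the pairs \<open>(u\<^sub>i, v\<^sub>i)\<close>.\<close>

definition is_shuffle :: "'c list \<Rightarrow> 'c list \<Rightarrow> ('c + 'c) list \<Rightarrow> bool" where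
  "is_shuffle u v w \<longleftrightarrow>
     (\<exists>ps. ps \<noteq> [] \<and> u = concat (map fst ps) \<and> v = concat (map snd ps) \<and>
        (\<forall>i < length ps. 0 < i \<longrightarrow> fst (ps ! i) \<noteq> []) \<and>
        (\<forall>j. Suc j < length ps \<longrightarrow> snd (ps ! j) \<noteq> []) \<and>
        w = concat (map (\<lambda>(x, y). map Inl x @ map Inr y) ps))"

record ('a, 'b, 's) two_tape = "('a tape_letter, 'b, 's) dpda" +
  sharp_states :: "'s set"
  flat_states :: "'s set"

definition is_two_tape :: "'a set \<Rightarrow> ('a, 'b, 's) two_tape \<Rightarrow> bool" where
  "is_two_tape A T \<longleftrightarrow>
     is_dpda T \<and> inputs T = tape_alphabet A \<and>
     sharp_states T \<union> flat_states T = states T \<and> sharp_states T \<inter> flat_states T = {}"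

text \<open>
  A step is subject to the restriction only if it consumes a letter; silent steps are allowed in
  all states.
\<close>

inductive two_tape_step ::
  "('a, 'b, 's) two_tape \<Rightarrow> ('a tape_letter, 'b, 's) config \<Rightarrow> ('a tape_letter, 'b, 's) config \<Rightarrow> bool"
  for T where
  "dpda_step T (u, z, s) (v, z', t) \<Longrightarrow>
   (\<And>x. u = Inl x # v \<Longrightarrow> s \<in> sharp_states T) \<Longrightarrow>
   (\<And>x. u = Inr x # v \<Longrightarrow> s \<in> flat_states T) \<Longrightarrow>
   two_tape_step T (u, z, s) (v, z', t)"

definition two_tape_lang ::
  "'a set \<Rightarrow> ('a, 'b, 's) two_tape \<Rightarrow> acceptance_mode \<Rightarrow> ('a list \<times> 'a list) set" where
  "two_tape_lang A T m =
     {(u, v). u \<in> lists A \<and> v \<in> lists A \<and>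
        (\<exists>w c. is_shuffle (end_marked u) (end_marked v) w \<and>
           (two_tape_step T)\<^sup>*\<^sup>* (initial_config T w) c \<and> accepting T m c)}"

definition is_two_tape_language :: "'a set \<Rightarrow> ('a list \<times> 'a list) set \<Rightarrow> bool" where
  "is_two_tape_language A R \<longleftrightarrow>
     (\<exists>(T :: ('a, nat, nat) two_tape) m. is_two_tape A T \<and> R = two_tape_lang A T m)"

definition at_parallel_poly_pushdown :: "'a set \<Rightarrow> ('a list \<times> 'a list) set \<Rightarrow> bool" where
  "at_parallel_poly_pushdown A R \<longleftrightarrow>
     (\<exists>F. finite F \<and> F \<noteq> {} \<and> (\<forall>K\<in>F. is_two_tape_language A K) \<and> R = \<Inter> F)"

section \<open>Parallel poly-pushdown groups\<close>

definition word_value :: "('g, 'm) monoid_scheme \<Rightarrow> ('a \<Rightarrow> 'g) \<Rightarrow> 'a list \<Rightarrow> 'g" where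
  "word_value G \<pi> w = foldr (\<otimes>\<^bsub>G\<^esub>) (map \<pi> w) \<one>\<^bsub>G\<^esub>"

definition monoid_generators :: "('g, 'm) monoid_scheme \<Rightarrow> 'a set \<Rightarrow> ('a \<Rightarrow> 'g) \<Rightarrow> bool" where
  "monoid_generators G A \<pi> \<longleftrightarrow>
     finite A \<and> \<pi> \<in> A \<rightarrow> carrier G \<and> word_value G \<pi> ` lists A = carrier G"

definition parallel_poly_pushdown_structure ::
  "('g, 'm) monoid_scheme \<Rightarrow> 'a set \<Rightarrow> ('a \<Rightarrow> 'g) \<Rightarrow> 'a list set \<Rightarrow> bool" where
  "parallel_poly_pushdown_structure G A \<pi> L \<longleftrightarrow>
     L \<subseteq> lists A \<and>
     bij_betw (word_value G \<pi>) L (carrier G) \<and>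
     parallel_poly_pushdown A L \<and>
     (\<forall>a\<in>A. at_parallel_poly_pushdown A
        {(w, w'). w \<in> L \<and> w' \<in> L \<and> word_value G \<pi> w' = word_value G \<pi> (w @ [a])})"

text \<open>Again the finite alphabet may be taken to be a set of natural numbers.\<close>

definition parallel_poly_pushdown_group :: "('g, 'm) monoid_scheme \<Rightarrow> bool" where
  "parallel_poly_pushdown_group G \<longleftrightarrow>
     group G \<and>
     (\<exists>(A :: nat set) \<pi> L. monoid_generators G A \<pi> \<and> parallel_poly_pushdown_structure G A \<pi> L)"

section \<open>Semidirect products\<close>

definition semidirect_product ::
  "('n, 'm) monoid_scheme \<Rightarrow> ('h, 'k) monoid_scheme \<Rightarrow> ('h \<Rightarrow> 'n \<Rightarrow> 'n) \<Rightarrow> ('n \<times> 'h) monoid" where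
  "semidirect_product N H \<phi> =
     \<lparr>carrier = carrier N \<times> carrier H,
      monoid.mult = (\<lambda>(x, h) (y, k). (x \<otimes>\<^bsub>N\<^esub> \<phi> h y, h \<otimes>\<^bsub>H\<^esub> k)),
      one = (\<one>\<^bsub>N\<^esub>, \<one>\<^bsub>H\<^esub>)\<rparr>"

lemma group_semidirect_product:
  assumes N: "group N" and H: "group H" and \<phi>: "\<phi> \<in> hom H (AutoGroup N)"
  shows "group (semidirect_product N H \<phi>)"
proof -
  interpret N: group N by fact
  interpret H: group H by fact
  interpret \<phi>: group_hom H "AutoGroup N" \<phi>
    using \<phi> by (simp add: group_hom_def group_hom_axioms_def H N.AutoGroup)
  have aut: "\<phi> h \<in> auto N" if "h \<in> carrier H" for h
    using \<phi>.hom_closed[OF that] by (simp add: AutoGroup_def)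
  have closed: "\<phi> h x \<in> carrier N" if "h \<in> carrier H" "x \<in> carrier N" for h x
    using aut[OF that(1)] that(2) by (auto simp: auto_def hom_def)
  have hom: "\<phi> h (x \<otimes>\<^bsub>N\<^esub> y) = \<phi> h x \<otimes>\<^bsub>N\<^esub> \<phi> h y"
    if "h \<in> carrier H" "x \<in> carrier N" "y \<in> carrier N" for h x y
    using aut[OF that(1)] that(2,3) by (auto simp: auto_def hom_def)
  have comp: "\<phi> (h \<otimes>\<^bsub>H\<^esub> k) x = \<phi> h (\<phi> k x)"
    if "h \<in> carrier H" "k \<in> carrier H" "x \<in> carrier N" for h k x
    using \<phi>.hom_mult[OF that(1,2)] aut[OF that(1)] aut[OF that(2)] that(3)
    by (simp add: AutoGroup_def BijGroup_def auto_def compose_def)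
  have id: "\<phi> \<one>\<^bsub>H\<^esub> x = x" if "x \<in> carrier N" for x
    using \<phi>.hom_one that by (simp add: AutoGroup_def BijGroup_def)
  show ?thesis
  proof (rule groupI, goal_cases)
    case (3 x y z)
    then show ?case
      by (auto simp: semidirect_product_def closed hom comp N.m_assoc H.m_assoc simp del: \<phi>.hom_mult)
  next
    case (5 x)
    then obtain v h where x: "x = (v, h)" "v \<in> carrier N" "h \<in> carrier H"
      by (auto simp: semidirect_product_def)
    let ?k = "inv\<^bsub>H\<^esub> h"
    have "(inv\<^bsub>N\<^esub> \<phi> ?k v, ?k) \<in> carrier (semidirect_product N H \<phi>)"
      using x by (simp add: semidirect_product_def closed del: \<phi>.hom_inv)
    moreover have "(inv\<^bsub>N\<^esub> \<phi> ?k v, ?k) \<otimes>\<^bsub>semidirect_product N H \<phi>\<^esub> x =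
        \<one>\<^bsub>semidirect_product N H \<phi>\<^esub>"
      using x by (simp add: semidirect_product_def closed del: \<phi>.hom_inv)
    ultimately show ?case by blast
  qed (auto simp: semidirect_product_def closed id simp del: \<phi>.hom_one)
qed

abbreviation int_power_group :: "nat \<Rightarrow> (nat \<Rightarrow> int) monoid" where
  "int_power_group n \<equiv> product_group {..<n} (\<lambda>_. integer_group)"

end

theory Submission
  imports Defs "HOL-Library.Countable"
begin

text \<open>
  Let \<open>L\<close> be the language of normal forms for \<open>H\<close>.  Every element of the semidirect product is
  \<open>(0, h) (y, 1) = (\<phi>\<^sub>h y, h)\<close> for unique \<open>h\<close> and \<open>y\<close>, and its normal form is the normal form of
  \<open>h\<close> in \<open>L\<close>, followed by a separating letter of trivial value and by a word for the vector \<open>y\<close>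
  in the letters \<open>\<plusminus>e\<^sub>i\<close>, sorted by \<open>i\<close> and without cancellation.  The point of writing the vector
  last is that
    \<open>(\<phi>\<^sub>h y, h) (t, g) = (\<phi>\<^sub>h (y + t), h g)\<close>,
  so that multiplication by a generator \<open>(t, g)\<close> leads to \<open>(\<phi>\<^sub>k x, k)\<close> if and only if \<open>k = h g\<close> and
  \<open>\<phi>\<^sub>g x = y + t\<close>: the matrix in the linear condition depends on the generator \<open>g\<close> only, and not on
  the unbounded element \<open>h\<close> (lemma \<open>multiplication_criterion\<close>).

  The relation \<open>k = h g\<close> between the first parts of the words is available from the structure of
  \<open>H\<close> if \<open>g\<close> is one of its letters, and it is the equality of two words of \<open>L\<close> if \<open>g = 1\<close>.  The
  linear condition consists of one equation between signed numbers of letters for each coordinate,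
  and an automaton with an integer counter decides such an equation
  (\<open>is_two_tape_language_linear\<close>).  The shape of the words is regular.  Since the languages in
  question are intersections, all these conditions can be imposed by separate automata.

  It remains to let automata for \<open>H\<close> run on the first parts of longer words, which is the content
  of \<open>is_dpda_language_prefix\<close> and \<open>is_two_tape_language_prefix\<close>.  On two tapes the separating
  letter takes the place of the end marker.  A one-tape automaton knows no end marker; it may even
  accept during an infinite sequence of silent moves, in which the separating letter is never read.
  There the simulation fetches each letter before it makes the silent moves that precede it.

  Two-tape automata are treated throughout as automata that read two words independently; this
  disposes of the shuffles (\<open>two_tape_lang_pair_accepts\<close>).
\<close>

section \<open>Runs of pushdown automata\<close>

lemma dpda_step_iff:
  "dpda_step M (u, z, s) (v, z', t) \<longleftrightarrow>
     (\<exists>y b \<alpha>. z = y @ [b] \<and> z' = y @ \<alpha> \<and>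
        (trans M None b s = Some (t, \<alpha>) \<and> v = u \<or>
         (\<exists>a. trans M (Some a) b s = Some (t, \<alpha>) \<and> u = a # v)))"
  by (subst dpda_step.simps) auto

lemma dpda_step_snoc:
  "dpda_step M (u, y @ [b], s) (v, z', t) \<longleftrightarrow>
     (\<exists>\<alpha>. z' = y @ \<alpha> \<and>
        (trans M None b s = Some (t, \<alpha>) \<and> v = u \<or>
         (\<exists>a. trans M (Some a) b s = Some (t, \<alpha>) \<and> u = a # v)))"
  by (auto simp: dpda_step_iff)

lemma dpda_step_Nil [simp]: "\<not> dpda_step M (u, [], s) c"
  by (cases c) (simp add: dpda_step_iff)

definition accepts ::
  "('a, 'b, 's, 'm) dpda_scheme \<Rightarrow> acceptance_mode \<Rightarrow> ('a, 'b, 's) config \<Rightarrow> bool" where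
  "accepts M m c \<longleftrightarrow> (\<exists>d. (dpda_step M)\<^sup>*\<^sup>* c d \<and> accepting M m d)"

lemma dpda_lang_accepts:
  "dpda_lang M m = {w \<in> lists (inputs M). accepts M m (w, [start_sym M], start_state M)}"
  by (simp add: dpda_lang_def accepts_def initial_config_def)

lemma accepts_accepting: "accepting M m c \<Longrightarrow> accepts M m c"
  unfolding accepts_def by blast

lemma accepts_step: "dpda_step M c d \<Longrightarrow> accepts M m d \<Longrightarrow> accepts M m c"
  unfolding accepts_def by (blast intro: converse_rtranclp_into_rtranclp)

lemma accepts_cases:
  assumes "accepts M m (u, z, s)"
  obtains "accepting M m (u, z, s)"
    | v z' t where "dpda_step M (u, z, s) (v, z', t)" "accepts M m (v, z', t)"
  using assms unfolding accepts_def by (metis converse_rtranclpE prod_cases3)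

lemma accepts_induct [consumes 1, case_names accepting step]:
  assumes "accepts M m (u, z, s)"
    and "\<And>u z s. accepting M m (u, z, s) \<Longrightarrow> P u z s"
    and "\<And>u z s v z' t. dpda_step M (u, z, s) (v, z', t) \<Longrightarrow> accepts M m (v, z', t) \<Longrightarrow>
           P v z' t \<Longrightarrow> P u z s"
  shows "P u z s"
proof -
  obtain d where run: "(dpda_step M)\<^sup>*\<^sup>* (u, z, s) d" and d: "accepting M m d"
    using assms(1) unfolding accepts_def by blast
  have "accepts M m c \<and> (case c of (u, z, s) \<Rightarrow> P u z s)" if "(dpda_step M)\<^sup>*\<^sup>* c d" for c
    using that
  proof (induction rule: converse_rtranclp_induct)
    case base
    then show ?case using d assms(2) by (auto intro: accepts_accepting)
  next
    case (step c e)
    then show ?case using assms(3) by (cases c; cases e) (auto intro: accepts_step)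
  qed
  from this[OF run] show ?thesis by simp
qed

lemma is_dpdaD:
  assumes "is_dpda M"
  shows "finite (states M)" "finite (inputs M)" "finite (stack_syms M)"
    "start_state M \<in> states M" "start_sym M \<in> stack_syms M" "final_states M \<subseteq> states M"
  using assms by (simp_all add: is_dpda_def)

lemma is_dpda_trans_closed:
  assumes "is_dpda M" "trans M x b s = Some (t, \<alpha>)"
  shows "x \<in> insert None (Some ` inputs M)" "b \<in> stack_syms M" "s \<in> states M"
    "t \<in> states M" "\<alpha> \<in> lists (stack_syms M)"
proof -
  have "\<forall>x b s t \<alpha>. trans M x b s = Some (t, \<alpha>) \<longrightarrow>
      x \<in> insert None (Some ` inputs M) \<and> b \<in> stack_syms M \<and> s \<in> states M \<and>
      t \<in> states M \<and> \<alpha> \<in> lists (stack_syms M)"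
    using assms(1) unfolding is_dpda_def by (elim conjE)
  then show "x \<in> insert None (Some ` inputs M)" "b \<in> stack_syms M" "s \<in> states M"
    "t \<in> states M" "\<alpha> \<in> lists (stack_syms M)"
    using assms(2) by blast+
qed

lemma is_dpda_reads_iff:
  assumes "is_dpda M" "b \<in> stack_syms M" "s \<in> states M" "a \<in> inputs M"
  shows "trans M (Some a) b s \<noteq> None \<longleftrightarrow> trans M None b s = None"
proof -
  have "\<forall>b\<in>stack_syms M. \<forall>s\<in>states M.
      trans M None b s \<noteq> None \<and> (\<forall>a\<in>inputs M. trans M (Some a) b s = None) \<or>
      trans M None b s = None \<and> (\<forall>a\<in>inputs M. trans M (Some a) b s \<noteq> None)"
    using assms(1) unfolding is_dpda_def by (elim conjE)
  from bspec[OF bspec[OF this assms(2)] assms(3)] show ?thesis using assms(4) by auto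
qed

lemma dpda_step_deterministic:
  assumes "is_dpda M" "dpda_step M c d" "dpda_step M c e"
  shows "d = e"
proof -
  have "trans M (Some a) b s = None" if "trans M None b s = Some (t, \<alpha>)" for a b s t \<alpha>
  proof (rule ccontr)
    assume *: "trans M (Some a) b s \<noteq> None"
    then have "a \<in> inputs M" using is_dpda_trans_closed(1)[OF assms(1)] by fastforce
    with * that show False
      using is_dpda_reads_iff[OF assms(1)] is_dpda_trans_closed(2,3)[OF assms(1) that] by fastforce
  qed
  then show ?thesis
    using assms(2,3) by (cases c; cases d; cases e) (fastforce simp: dpda_step_iff)
qed

text \<open>
  Determinism turns an explicitly computed run into a decision of acceptance, provided that the
  accepting configurations have no successors either.
\<close>

lemma accepts_iff_halting_run:
  assumes "is_dpda M" "(dpda_step M)\<^sup>*\<^sup>* c e" "\<And>f. \<not> dpda_step M e f"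
    and "\<And>d f. accepting M m d \<Longrightarrow> \<not> dpda_step M d f"
  shows "accepts M m c \<longleftrightarrow> accepting M m e"
proof
  assume "accepts M m c"
  then obtain d where d: "(dpda_step M)\<^sup>*\<^sup>* c d" "accepting M m d" unfolding accepts_def by blast
  have "(dpda_step M)\<^sup>*\<^sup>* c e \<Longrightarrow> e = d"
    using d(1)
  proof (induction rule: converse_rtranclp_induct)
    case base
    then show ?case using assms(4) d(2) by (metis converse_rtranclpE)
  next
    case (step c c')
    then show ?case using assms(1,3) dpda_step_deterministic by (metis converse_rtranclpE)
  qed
  then show "accepting M m e" using assms(2) d(2) by simp
qed (use assms(2) in \<open>unfold accepts_def, blast\<close>)

section \<open>Two-tape automata as automata reading two words\<close>

fun pair_step ::
  "('a, 'b, 's) two_tape \<Rightarrow> 'a option list \<times> 'a option list \<times> 'b list \<times> 's \<Rightarrow>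
     'a option list \<times> 'a option list \<times> 'b list \<times> 's \<Rightarrow> bool" where
  "pair_step T (u, v, z, s) (u', v', z', t) \<longleftrightarrow>
     (\<exists>y b \<alpha>. z = y @ [b] \<and> z' = y @ \<alpha> \<and>
        (trans T None b s = Some (t, \<alpha>) \<and> u' = u \<and> v' = v \<or>
         (\<exists>a. s \<in> sharp_states T \<and> trans T (Some (Inl a)) b s = Some (t, \<alpha>) \<and>
              u = a # u' \<and> v' = v) \<or>
         (\<exists>a. s \<in> flat_states T \<and> trans T (Some (Inr a)) b s = Some (t, \<alpha>) \<and>
              u' = u \<and> v = a # v')))"

lemma pair_step_snoc:
  "pair_step T (u, v, y @ [b], s) (u', v', z', t) \<longleftrightarrow>
     (\<exists>\<alpha>. z' = y @ \<alpha> \<and>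
        (trans T None b s = Some (t, \<alpha>) \<and> u' = u \<and> v' = v \<or>
         (\<exists>a. s \<in> sharp_states T \<and> trans T (Some (Inl a)) b s = Some (t, \<alpha>) \<and>
              u = a # u' \<and> v' = v) \<or>
         (\<exists>a. s \<in> flat_states T \<and> trans T (Some (Inr a)) b s = Some (t, \<alpha>) \<and>
              u' = u \<and> v = a # v')))"
  by auto

lemma pair_step_Nil [simp]: "\<not> pair_step T (u, v, [], s) c"
  by (cases c) simp

declare pair_step.simps [simp del]

definition pair_accepts ::
  "('a, 'b, 's) two_tape \<Rightarrow> acceptance_mode \<Rightarrow>
     'a option list \<times> 'a option list \<times> 'b list \<times> 's \<Rightarrow> bool" where
  "pair_accepts T m c \<longleftrightarrow>
     (\<exists>z t. (pair_step T)\<^sup>*\<^sup>* c ([], [], z, t) \<and> accepting T m ([], z, t))"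

lemma pair_accepts_accepting: "accepting T m ([], z, t) \<Longrightarrow> pair_accepts T m ([], [], z, t)"
  by (auto simp: pair_accepts_def)

lemma pair_accepts_step: "pair_step T c d \<Longrightarrow> pair_accepts T m d \<Longrightarrow> pair_accepts T m c"
  by (auto simp: pair_accepts_def intro: converse_rtranclp_into_rtranclp)

lemma pair_accepts_cases:
  assumes "pair_accepts T m (u, v, z, s)"
  obtains "u = []" "v = []" "accepting T m ([], z, s)"
    | u' v' z' t where "pair_step T (u, v, z, s) (u', v', z', t)" "pair_accepts T m (u', v', z', t)"
proof -
  obtain y t where "(pair_step T)\<^sup>*\<^sup>* (u, v, z, s) ([], [], y, t)" "accepting T m ([], y, t)"
    using assms unfolding pair_accepts_def by blast
  then show ?thesis
  proof (cases rule: converse_rtranclpE)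
    case base
    then show ?thesis using that(1) \<open>accepting T m ([], y, t)\<close> by simp
  next
    case (step c)
    then show ?thesis
      using that(2) \<open>accepting T m ([], y, t)\<close> unfolding pair_accepts_def by (cases c) blast
  qed
qed

lemma pair_accepts_induct [consumes 1, case_names accepting step]:
  assumes "pair_accepts T m (u, v, z, s)"
    and "\<And>z s. accepting T m ([], z, s) \<Longrightarrow> P [] [] z s"
    and "\<And>u v z s u' v' z' t. pair_step T (u, v, z, s) (u', v', z', t) \<Longrightarrow>
           pair_accepts T m (u', v', z', t) \<Longrightarrow> P u' v' z' t \<Longrightarrow> P u v z s"
  shows "P u v z s"
proof -
  obtain z' t where run: "(pair_step T)\<^sup>*\<^sup>* (u, v, z, s) ([], [], z', t)"
    and d: "accepting T m ([], z', t)"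
    using assms(1) by (auto simp: pair_accepts_def)
  have "pair_accepts T m c \<and> (case c of (u, v, z, s) \<Rightarrow> P u v z s)"
    if "(pair_step T)\<^sup>*\<^sup>* c ([], [], z', t)" for c
    using that
  proof (induction rule: converse_rtranclp_induct)
    case base
    then show ?case using d assms(2) by (auto intro: pair_accepts_accepting)
  next
    case (step c e)
    obtain u v z s where [simp]: "c = (u, v, z, s)" by (cases c)
    obtain u' v' z' s' where [simp]: "e = (u', v', z', s')" by (cases e)
    from step have "pair_accepts T m e" "P u' v' z' s'" by simp_all
    then show ?case
      using assms(3) pair_accepts_step step.hyps(1)
      by (metis \<open>c = (u, v, z, s)\<close> \<open>e = (u', v', z', s')\<close> case_prod_conv)
  qed
  from this[OF run] show ?thesis by simp
qed

fun lefts :: "('c + 'd) list \<Rightarrow> 'c list" where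
  "lefts [] = []"
| "lefts (Inl x # w) = x # lefts w"
| "lefts (Inr y # w) = lefts w"

fun rights :: "('c + 'd) list \<Rightarrow> 'd list" where
  "rights [] = []"
| "rights (Inl x # w) = rights w"
| "rights (Inr y # w) = y # rights w"

lemma lefts_append [simp]: "lefts (v @ w) = lefts v @ lefts w"
  and rights_append [simp]: "rights (v @ w) = rights v @ rights w"
  by (induction v rule: lefts.induct) auto

lemma lefts_map [simp]: "lefts (map Inl u) = u" "lefts (map Inr v) = []"
  and rights_map [simp]: "rights (map Inl u) = []" "rights (map Inr v) = v"
  by (induction u; simp; fail | induction v; simp; fail)+

text \<open>
  The side conditions on the factors only make the factorisation of a shuffle canonical.  Reading a
  word from its right end, a letter \<open>x\<^sup>\<sharp>\<close> joins the first factor, while a letter \<open>y\<^sup>\<flat>\<close> joins it only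
  if it starts with \<open>\<flat>\<close> letters.
\<close>

lemma is_shuffle_iff: "is_shuffle u v w \<longleftrightarrow> lefts w = u \<and> rights w = v"
proof
  assume "is_shuffle u v w"
  then obtain ps where "u = concat (map fst ps)" "v = concat (map snd ps)"
    "w = concat (map (\<lambda>(x, y). map Inl x @ map Inr y) ps)"
    by (auto simp: is_shuffle_def)
  then show "lefts w = u \<and> rights w = v"
    by (induction ps arbitrary: u v w) auto
next
  have "is_shuffle (lefts w) (rights w) w"
  proof (induction w rule: lefts.induct)
    case 1
    show ?case unfolding is_shuffle_def by (rule exI[of _ "[([], [])]"]) auto
  next
    case (2 x w)
    then obtain ps where ps: "ps \<noteq> []" "lefts w = concat (map fst ps)"
      "rights w = concat (map snd ps)" "\<forall>i<length ps. 0 < i \<longrightarrow> fst (ps ! i) \<noteq> []"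
      "\<forall>j. Suc j < length ps \<longrightarrow> snd (ps ! j) \<noteq> []"
      "w = concat (map (\<lambda>(x, y). map Inl x @ map Inr y) ps)"
      by (auto simp: is_shuffle_def)
    obtain p q qs where [simp]: "ps = (p, q) # qs" using ps(1) by (cases ps) auto
    show ?case
      unfolding is_shuffle_def
      using ps by (intro exI[of _ "(x # p, q) # qs"]) (auto simp: nth_Cons split: nat.splits)
  next
    case (3 y w)
    then obtain ps where ps: "ps \<noteq> []" "lefts w = concat (map fst ps)"
      "rights w = concat (map snd ps)" "\<forall>i<length ps. 0 < i \<longrightarrow> fst (ps ! i) \<noteq> []"
      "\<forall>j. Suc j < length ps \<longrightarrow> snd (ps ! j) \<noteq> []"
      "w = concat (map (\<lambda>(x, y). map Inl x @ map Inr y) ps)"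
      by (auto simp: is_shuffle_def)
    obtain p q qs where [simp]: "ps = (p, q) # qs" using ps(1) by (cases ps) auto
    show ?case
    proof (cases "p = []")
      case True
      then show ?thesis
        unfolding is_shuffle_def
        using ps by (intro exI[of _ "([], y # q) # qs"]) (auto simp: nth_Cons split: nat.splits)
    next
      case False
      then show ?thesis
        unfolding is_shuffle_def
        using ps by (intro exI[of _ "([], [y]) # (p, q) # qs"])
          (auto simp: nth_Cons split: nat.splits)
    qed
  qed
  then show "lefts w = u \<and> rights w = v \<Longrightarrow> is_shuffle u v w" by auto
qed

lemma two_tape_step_iff:
  "two_tape_step T (u, z, s) (v, z', t) \<longleftrightarrow>
     dpda_step T (u, z, s) (v, z', t) \<and>
     (\<forall>x. u = Inl x # v \<longrightarrow> s \<in> sharp_states T) \<and> (\<forall>x. u = Inr x # v \<longrightarrow> s \<in> flat_states T)"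
  by (subst two_tape_step.simps) auto

lemma pair_step_of_two_tape_step:
  assumes "two_tape_step T (w, z, s) (w', z', t)"
  shows "pair_step T (lefts w, rights w, z, s) (lefts w', rights w', z', t)"
proof -
  from assms consider "\<exists>y b \<alpha>. z = y @ [b] \<and> z' = y @ \<alpha> \<and> trans T None b s = Some (t, \<alpha>) \<and> w' = w"
    | a y b \<alpha> where "z = y @ [b]" "z' = y @ \<alpha>" "trans T (Some a) b s = Some (t, \<alpha>)" "w = a # w'"
    by (auto simp: two_tape_step_iff dpda_step_iff)
  then show ?thesis
  proof cases
    case 1
    then show ?thesis by (auto simp: pair_step.simps)
  next
    case (2 a)
    then show ?thesis using assms by (cases a) (auto simp: pair_step.simps two_tape_step_iff)
  qed
qed

lemma two_tape_step_of_pair_step: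
  assumes "pair_step T (u, v, z, s) (lefts w', rights w', z', t)"
  shows "\<exists>w. lefts w = u \<and> rights w = v \<and> two_tape_step T (w, z, s) (w', z', t)"
proof -
  from assms consider
      "\<exists>y b \<alpha>. z = y @ [b] \<and> z' = y @ \<alpha> \<and> trans T None b s = Some (t, \<alpha>)" "u = lefts w'" "v = rights w'"
    | a y b \<alpha> where "z = y @ [b]" "z' = y @ \<alpha>" "trans T (Some (Inl a)) b s = Some (t, \<alpha>)"
        "s \<in> sharp_states T" "u = a # lefts w'" "v = rights w'"
    | a y b \<alpha> where "z = y @ [b]" "z' = y @ \<alpha>" "trans T (Some (Inr a)) b s = Some (t, \<alpha>)"
        "s \<in> flat_states T" "u = lefts w'" "v = a # rights w'"
    by (auto simp: pair_step.simps)
  then show ?thesis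
  proof cases
    case 1
    then show ?thesis by (intro exI[of _ w']) (auto simp: two_tape_step_iff dpda_step_iff)
  next
    case (2 a)
    then show ?thesis by (intro exI[of _ "Inl a # w'"]) (auto simp: two_tape_step_iff dpda_step_iff)
  next
    case (3 a)
    then show ?thesis by (intro exI[of _ "Inr a # w'"]) (auto simp: two_tape_step_iff dpda_step_iff)
  qed
qed

text \<open>
  The automaton determines the shuffle: a run on a pair of words records in which order the letters
  are consumed.
\<close>

lemma two_tape_lang_pair_accepts:
  "two_tape_lang A T m =
     {(u, v). u \<in> lists A \<and> v \<in> lists A \<and>
        pair_accepts T m (end_marked u, end_marked v, [start_sym T], start_state T)}"
proof -
  have "(\<exists>w c. is_shuffle u v w \<and> (two_tape_step T)\<^sup>*\<^sup>* (w, z, s) c \<and> accepting T m c) \<longleftrightarrow>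
    pair_accepts T m (u, v, z, s)" for u v z s
  proof
    assume "\<exists>w c. is_shuffle u v w \<and> (two_tape_step T)\<^sup>*\<^sup>* (w, z, s) c \<and> accepting T m c"
    then obtain w c where w: "lefts w = u" "rights w = v"
      and run: "(two_tape_step T)\<^sup>*\<^sup>* (w, z, s) c" and acc: "accepting T m c"
      by (auto simp: is_shuffle_iff)
    have "case c' of (w, z, s) \<Rightarrow> pair_accepts T m (lefts w, rights w, z, s)"
      if "(two_tape_step T)\<^sup>*\<^sup>* c' c" for c'
      using that
    proof (induction rule: converse_rtranclp_induct)
      case base
      have "fst c = []" using acc by (cases c; cases m) auto
      then show ?case using acc by (cases c) (auto intro: pair_accepts_accepting)
    next
      case (step c' d)
      then show ?case
        by (cases c'; cases d) (auto dest!: pair_step_of_two_tape_step intro: pair_accepts_step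
)
    qed
    from this[OF run] show "pair_accepts T m (u, v, z, s)" using w by simp
  next
    assume "pair_accepts T m (u, v, z, s)"
    then show "\<exists>w c. is_shuffle u v w \<and> (two_tape_step T)\<^sup>*\<^sup>* (w, z, s) c \<and> accepting T m c"
    proof (induction rule: pair_accepts_induct)
      case (accepting z s)
      then show ?case by (intro exI[of _ "[]"]) (auto simp: is_shuffle_iff)
    next
      case (step u v z s u' v' z' t)
      then obtain w' c where "lefts w' = u'" "rights w' = v'"
        "(two_tape_step T)\<^sup>*\<^sup>* (w', z', t) c" "accepting T m c"
        by (auto simp: is_shuffle_iff)
      moreover from this step.hyps(1) obtain w where "lefts w = u" "rights w = v"
        "two_tape_step T (w, z, s) (w', z', t)"
        using two_tape_step_of_pair_step[of T u v z s w' z' t] by auto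
      ultimately show ?case
        unfolding is_shuffle_iff by (blast intro: converse_rtranclp_into_rtranclp)
    qed
  qed
  then show ?thesis by (simp add: two_tape_lang_def initial_config_def)
qed

section \<open>Building automata\<close>

text \<open>
  Whether a deterministic automaton moves silently or reads a letter depends on its state and its
  top symbol only.  Giving this decision as the value of a total function makes the conditions on
  the domain of the transition map automatic.
\<close>

datatype ('a, 'b, 's) action = Silent "'s \<times> 'b list" | Read "'a \<Rightarrow> 's \<times> 'b list"

definition machine ::
  "'a set \<Rightarrow> 'b set \<Rightarrow> 's set \<Rightarrow> ('s \<Rightarrow> 'b \<Rightarrow> ('a, 'b, 's) action) \<Rightarrow> 's \<Rightarrow> 'b \<Rightarrow> 's set \<Rightarrow>
     ('a, 'b, 's) dpda" where
  "machine A B S act s0 z0 F =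
     \<lparr>states = S, inputs = A, stack_syms = B,
      trans = (\<lambda>x b s. if b \<in> B \<and> s \<in> S then
         (case act s b of
            Silent p \<Rightarrow> (if x = None then Some p else None)
          | Read f \<Rightarrow> (case x of None \<Rightarrow> None | Some a \<Rightarrow> if a \<in> A then Some (f a) else None))
         else None),
      start_state = s0, start_sym = z0, final_states = F\<rparr>"

fun action_within :: "'a set \<Rightarrow> 'b set \<Rightarrow> 's set \<Rightarrow> ('a, 'b, 's) action \<Rightarrow> bool" where
  "action_within A B S (Silent p) \<longleftrightarrow> p \<in> S \<times> lists B"
| "action_within A B S (Read f) \<longleftrightarrow> (\<forall>a\<in>A. f a \<in> S \<times> lists B)"

lemma machine_simps [simp]:
  "states (machine A B S act s0 z0 F) = S"
  "inputs (machine A B S act s0 z0 F) = A"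
  "stack_syms (machine A B S act s0 z0 F) = B"
  "start_state (machine A B S act s0 z0 F) = s0"
  "start_sym (machine A B S act s0 z0 F) = z0"
  "final_states (machine A B S act s0 z0 F) = F"
  by (simp_all add: machine_def)

lemma trans_machine_None:
  "trans (machine A B S act s0 z0 F) None b s = Some p \<longleftrightarrow>
     b \<in> B \<and> s \<in> S \<and> act s b = Silent p"
  by (auto simp: machine_def split: action.splits)

lemma trans_machine_Some:
  "trans (machine A B S act s0 z0 F) (Some a) b s = Some p \<longleftrightarrow>
     b \<in> B \<and> s \<in> S \<and> a \<in> A \<and> (\<exists>f. act s b = Read f \<and> p = f a)"
  by (auto simp: machine_def split: action.splits)

lemma is_dpda_machine:
  assumes "finite A" "finite B" "finite S" "s0 \<in> S" "z0 \<in> B" "F \<subseteq> S"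
    and act: "\<And>s b. s \<in> S \<Longrightarrow> b \<in> B \<Longrightarrow> action_within A B S (act s b)"
  shows "is_dpda (machine A B S act s0 z0 F)" (is "is_dpda ?M")
proof -
  have 1: "x \<in> insert None (Some ` A) \<and> b \<in> B \<and> s \<in> S \<and> t \<in> S \<and> \<alpha> \<in> lists B"
    if "trans ?M x b s = Some (t, \<alpha>)" for x b s t \<alpha>
    using that act[of s b]
    by (cases x; cases "act s b") (force simp: trans_machine_None trans_machine_Some)+
  have 2: "(trans ?M None b s \<noteq> None \<and> (\<forall>a\<in>A. trans ?M (Some a) b s = None)) \<or>
        (trans ?M None b s = None \<and> (\<forall>a\<in>A. trans ?M (Some a) b s \<noteq> None))"
    if "b \<in> B" "s \<in> S" for b s
    using that by (cases "act s b") (auto simp: machine_def)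
  show ?thesis
    unfolding is_dpda_def machine_simps
    by (intro conjI allI ballI impI 2) (use assms(1-6) 1 in blast)+
qed

lemma machine_step:
  "dpda_step (machine A B S act s0 z0 F) (u, z @ [b], s) (v, z', t) \<longleftrightarrow>
     b \<in> B \<and> s \<in> S \<and>
     (case act s b of
        Silent (t', \<alpha>) \<Rightarrow> v = u \<and> z' = z @ \<alpha> \<and> t = t'
      | Read f \<Rightarrow> \<exists>a\<in>A. u = a # v \<and> z' = z @ snd (f a) \<and> t = fst (f a))"
  by (cases "act s b")
    (auto simp: dpda_step_snoc trans_machine_None trans_machine_Some prod_eq_iff)

lemma machine_step_silent:
  "act s b = Silent (t, \<alpha>) \<Longrightarrow> b \<in> B \<Longrightarrow> s \<in> S \<Longrightarrow>
     dpda_step (machine A B S act s0 z0 F) (u, z @ [b], s) (u, z @ \<alpha>, t)"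
  by (simp add: machine_step)

lemma machine_step_read:
  "act s b = Read f \<Longrightarrow> f a = (t, \<alpha>) \<Longrightarrow> b \<in> B \<Longrightarrow> s \<in> S \<Longrightarrow> a \<in> A \<Longrightarrow>
     dpda_step (machine A B S act s0 z0 F) (a # u, z @ [b], s) (u, z @ \<alpha>, t)"
  by (simp add: machine_step)

definition with_tapes :: "('a tape_letter, 'b, 's) dpda \<Rightarrow> ('s \<Rightarrow> bool) \<Rightarrow> ('a, 'b, 's) two_tape" where
  "with_tapes M sharp =
     dpda.extend M (two_tape.fields {s \<in> states M. sharp s} {s \<in> states M. \<not> sharp s})"

lemma with_tapes_simps [simp]:
  "states (with_tapes M sharp) = states M"
  "inputs (with_tapes M sharp) = inputs M"
  "stack_syms (with_tapes M sharp) = stack_syms M"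
  "trans (with_tapes M sharp) = trans M"
  "start_state (with_tapes M sharp) = start_state M"
  "start_sym (with_tapes M sharp) = start_sym M"
  "final_states (with_tapes M sharp) = final_states M"
  "sharp_states (with_tapes M sharp) = {s \<in> states M. sharp s}"
  "flat_states (with_tapes M sharp) = {s \<in> states M. \<not> sharp s}"
  by (simp_all add: with_tapes_def dpda.defs two_tape.defs)

lemma is_two_tape_with_tapes:
  "is_dpda M \<Longrightarrow> inputs M = tape_alphabet A \<Longrightarrow> is_two_tape A (with_tapes M sharp)"
  by (auto simp: is_two_tape_def is_dpda_def)

lemma with_tapes_step:
  "pair_step (with_tapes (machine A B S act s0 z0 F) sharp) (u, v, z @ [b], s) (u', v', z', t) \<longleftrightarrow>
     b \<in> B \<and> s \<in> S \<and>
     (case act s b of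
        Silent (t', \<alpha>) \<Rightarrow> u' = u \<and> v' = v \<and> z' = z @ \<alpha> \<and> t = t'
      | Read f \<Rightarrow>
          if sharp s
          then \<exists>a. Inl a \<in> A \<and> u = a # u' \<and> v' = v \<and> z' = z @ snd (f (Inl a)) \<and> t = fst (f (Inl a))
          else \<exists>a. Inr a \<in> A \<and> v = a # v' \<and> u' = u \<and> z' = z @ snd (f (Inr a)) \<and> t = fst (f (Inr a)))"
  by (cases "act s b") (auto simp: pair_step_snoc trans_machine_None trans_machine_Some prod_eq_iff)

lemma with_tapes_step_silent:
  "act s b = Silent (t, \<alpha>) \<Longrightarrow> b \<in> B \<Longrightarrow> s \<in> S \<Longrightarrow>
     pair_step (with_tapes (machine A B S act s0 z0 F) sharp) (u, v, z @ [b], s) (u, v, z @ \<alpha>, t)"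
  by (simp add: with_tapes_step)

section \<open>States and stack symbols as natural numbers\<close>

definition numbered :: "('a, 'b::countable, 's::countable) dpda \<Rightarrow> ('a, nat, nat) dpda" where
  "numbered M =
     \<lparr>states = to_nat ` states M, inputs = inputs M, stack_syms = to_nat ` stack_syms M,
      trans = (\<lambda>x b s. if b \<in> range (to_nat :: 'b \<Rightarrow> nat) \<and> s \<in> range (to_nat :: 's \<Rightarrow> nat)
         then map_option (map_prod to_nat (map to_nat)) (trans M x (from_nat b) (from_nat s))
         else None),
      start_state = to_nat (start_state M), start_sym = to_nat (start_sym M),
      final_states = to_nat ` final_states M\<rparr>"

lemma numbered_simps [simp]:
  "states (numbered M) = to_nat ` states M"
  "inputs (numbered M) = inputs M"
  "stack_syms (numbered M) = to_nat ` stack_syms M"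
  "start_state (numbered M) = to_nat (start_state M)"
  "start_sym (numbered M) = to_nat (start_sym M)"
  "final_states (numbered M) = to_nat ` final_states M"
  by (simp_all add: numbered_def)

lemma trans_numbered_to_nat [simp]:
  "trans (numbered M) x (to_nat b) (to_nat s) =
     map_option (map_prod to_nat (map to_nat)) (trans M x b s)"
  by (simp add: numbered_def)

lemma trans_numbered_Some:
  fixes M :: "('a, 'b::countable, 'c::countable) dpda"
  shows
  "trans (numbered M) x b s = Some (t, \<alpha>) \<longleftrightarrow>
     (\<exists>b' s' t' \<alpha>'. b = to_nat b' \<and> s = to_nat s' \<and> t = to_nat t' \<and> \<alpha> = map to_nat \<alpha>' \<and>
        trans M x b' s' = Some (t', \<alpha>'))"
proof
  assume *: "trans (numbered M) x b s = Some (t, \<alpha>)"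
  then have "b \<in> range (to_nat :: 'b \<Rightarrow> nat)" "s \<in> range (to_nat :: 'c \<Rightarrow> nat)"
    by (auto simp: numbered_def split: if_splits)
  then obtain b' :: 'b and s' :: 'c where "b = to_nat b'" "s = to_nat s'"
    by (elim rangeE)
  with * show "\<exists>b' s' t' \<alpha>'. b = to_nat b' \<and> s = to_nat s' \<and> t = to_nat t' \<and> \<alpha> = map to_nat \<alpha>' \<and>
        trans M x b' s' = Some (t', \<alpha>')"
    by auto
qed auto

lemma is_dpda_numbered:
  assumes "is_dpda M"
  shows "is_dpda (numbered M)"
proof -
  have 1: "x \<in> insert None (Some ` inputs M) \<and> b \<in> to_nat ` stack_syms M \<and> s \<in> to_nat ` states M \<and>
       t \<in> to_nat ` states M \<and> \<alpha> \<in> lists (to_nat ` stack_syms M)"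
    if "trans (numbered M) x b s = Some (t, \<alpha>)" for x b s t \<alpha>
  proof -
    from that obtain b' s' t' \<alpha>' where eq: "b = to_nat b'" "s = to_nat s'" "t = to_nat t'"
      "\<alpha> = map to_nat \<alpha>'" and *: "trans M x b' s' = Some (t', \<alpha>')"
      by (auto simp: trans_numbered_Some)
    show ?thesis
      using is_dpda_trans_closed[OF assms *] eq by (simp add: lists_image)
  qed
  have 2: "(trans (numbered M) None b s \<noteq> None \<and> (\<forall>a\<in>inputs M. trans (numbered M) (Some a) b s = None)) \<or>
        (trans (numbered M) None b s = None \<and> (\<forall>a\<in>inputs M. trans (numbered M) (Some a) b s \<noteq> None))"
    if "b \<in> to_nat ` stack_syms M" "s \<in> to_nat ` states M" for b s
  proof -
    from that obtain b' s' where eq: "b = to_nat b'" "s = to_nat s'"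
      and *: "b' \<in> stack_syms M" "s' \<in> states M" by blast
    show ?thesis using is_dpda_reads_iff[OF assms *] eq by (auto simp del: not_None_eq)
  qed
  show ?thesis
    unfolding is_dpda_def numbered_simps
    by (intro conjI allI ballI impI 2) (use 1 is_dpdaD[OF assms] in \<open>blast intro: finite_imageI\<close>)+
qed

lemma accepting_numbered [simp]:
  "accepting (numbered M) m (u, map to_nat z, to_nat s) = accepting M m (u, z, s)"
  by (cases m) auto

lemma accepts_numbered_imp:
  assumes "accepts (numbered M) m (u, z, s)"
  shows "z = map to_nat z' \<Longrightarrow> s = to_nat s' \<Longrightarrow> accepts M m (u, z', s')"
  using assms
proof (induction arbitrary: z' s' rule: accepts_induct)
  case (accepting u z s)
  then show ?case by (auto intro: accepts_accepting)
next
  case (step u z s v y t)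
  obtain x b where z': "z' = x @ [b]"
    using step.hyps(1) step.prems by (cases z' rule: rev_cases) auto
  with step.hyps(1) step.prems obtain \<alpha> t' where "y = map to_nat (x @ \<alpha>)" "t = to_nat t'"
    "dpda_step M (u, z', s') (v, x @ \<alpha>, t')"
    by (auto simp: dpda_step_snoc)
  then show ?case using step.IH by (blast intro: accepts_step)
qed

lemma accepts_imp_numbered:
  assumes "accepts M m (u, z, s)"
  shows "accepts (numbered M) m (u, map to_nat z, to_nat s)"
  using assms
proof (induction rule: accepts_induct)
  case (accepting u z s)
  then show ?case by (auto intro: accepts_accepting)
next
  case (step u z s v y t)
  then have "dpda_step (numbered M) (u, map to_nat z, to_nat s) (v, map to_nat y, to_nat t)"
    by (cases z rule: rev_cases) (auto simp: dpda_step_snoc)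
  then show ?case using step.IH by (blast intro: accepts_step)
qed

text \<open>
  The automata below are described with datatypes of states and stack symbols; countability
  provides the injection into the natural numbers.
\<close>

lemma is_dpda_language_of_countable:
  fixes M :: "('a, 'b::countable, 's::countable) dpda"
  assumes "is_dpda M"
  shows "is_dpda_language (inputs M) (dpda_lang M m)"
proof -
  have "dpda_lang M m = dpda_lang (numbered M) m"
    using accepts_numbered_imp[of M m _ "map to_nat [start_sym M]" "to_nat (start_state M)"]
      accepts_imp_numbered[of M m _ "[start_sym M]" "start_state M"]
    by (auto simp: dpda_lang_accepts)
  then show ?thesis
    using is_dpda_numbered[OF assms] unfolding is_dpda_language_def
    by (intro exI[of _ "numbered M"] exI[of _ m]) simp
qed

lemma pair_accepts_numbered_imp:
  assumes "pair_accepts (with_tapes (numbered M) (\<lambda>s. sharp (from_nat s))) m (u, v, z, s)"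
    (is "pair_accepts ?T m _")
  shows "z = map to_nat z' \<Longrightarrow> s = to_nat s' \<Longrightarrow> pair_accepts (with_tapes M sharp) m (u, v, z', s')"
  using assms
proof (induction arbitrary: z' s' rule: pair_accepts_induct)
  case (accepting z s)
  then show ?case by (cases m) (auto intro!: pair_accepts_accepting)
next
  case (step u v z s u1 v1 y t)
  obtain x b where z': "z' = x @ [b]"
    using step.hyps(1) step.prems by (cases z' rule: rev_cases) auto
  with step.hyps(1) step.prems obtain \<alpha> t' where "y = map to_nat (x @ \<alpha>)" "t = to_nat t'"
    "pair_step (with_tapes M sharp) (u, v, z', s') (u1, v1, x @ \<alpha>, t')"
    by (auto simp: pair_step_snoc)
  then show ?case using step.IH by (blast intro: pair_accepts_step)
qed

lemma pair_accepts_imp_numbered: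
  assumes "pair_accepts (with_tapes M sharp) m (u, v, z, s)"
  shows "pair_accepts (with_tapes (numbered M) (\<lambda>s. sharp (from_nat s))) m
    (u, v, map to_nat z, to_nat s)"
    (is "pair_accepts ?T m _")
  using assms
proof (induction rule: pair_accepts_induct)
  case (accepting z s)
  then show ?case by (cases m) (auto intro!: pair_accepts_accepting)
next
  case (step u v z s u' v' y t)
  then have "pair_step ?T (u, v, map to_nat z, to_nat s) (u', v', map to_nat y, to_nat t)"
    by (cases z rule: rev_cases) (auto simp: pair_step_snoc)
  then show ?case using step.IH by (blast intro: pair_accepts_step)
qed

lemma is_two_tape_language_of_countable:
  fixes M :: "('a tape_letter, 'b::countable, 's::countable) dpda"
  assumes "is_dpda M" "inputs M = tape_alphabet A"
  shows "is_two_tape_language A (two_tape_lang A (with_tapes M sharp) m)"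
proof -
  let ?T = "with_tapes (numbered M) (\<lambda>s. sharp (from_nat s))"
  have "two_tape_lang A (with_tapes M sharp) m = two_tape_lang A ?T m"
    using pair_accepts_numbered_imp[of M sharp m _ _ "map to_nat [start_sym M]" "to_nat (start_state M)"]
      pair_accepts_imp_numbered[of M sharp m _ _ "[start_sym M]" "start_state M"]
    by (auto simp: two_tape_lang_pair_accepts)
  moreover have "is_two_tape A ?T"
    using is_dpda_numbered[OF assms(1)] assms(2) by (intro is_two_tape_with_tapes) simp_all
  ultimately show ?thesis
    unfolding is_two_tape_language_def by (intro exI[of _ ?T] exI[of _ m] conjI)
qed

section \<open>Recognising a prefix that is cut off by an end letter\<close>

lemma dpda_step_closed:
  assumes "is_dpda M" "dpda_step M (u, z, s) (v, z', t)"
    "u \<in> lists (inputs M)" "z \<in> lists (stack_syms M)"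
  shows "s \<in> states M" "v \<in> lists (inputs M)" "z' \<in> lists (stack_syms M)" "t \<in> states M"
proof -
  obtain y b \<alpha> x where *: "z = y @ [b]" "z' = y @ \<alpha>" "trans M x b s = Some (t, \<alpha>)" "v = u \<or> (\<exists>a. u = a # v)"
    using assms(2) by (auto simp: dpda_step_iff)
  show "s \<in> states M" "v \<in> lists (inputs M)" "z' \<in> lists (stack_syms M)" "t \<in> states M"
    using * assms(3,4) is_dpda_trans_closed[OF assms(1) *(3)] by auto
qed

text \<open>
  A simulating automaton must not get stuck when the simulated one empties its stack, so it works
  above a bottom symbol of its own.
\<close>

definition bottomed :: "'b list \<Rightarrow> 'b option list" where
  "bottomed z = None # map Some z"

lemma bottomed_append [simp]: "bottomed (y @ \<alpha>) = bottomed y @ map Some \<alpha>"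
  by (simp add: bottomed_def)

lemma bottomed_Nil [simp]: "bottomed [] = [None]"
  by (simp add: bottomed_def)

fun accepting_top ::
  "('a, 'b, 's, 'm) dpda_scheme \<Rightarrow> acceptance_mode \<Rightarrow> 's \<Rightarrow> 'b option \<Rightarrow> bool" where
  "accepting_top M Final_State s b \<longleftrightarrow> s \<in> final_states M"
| "accepting_top M Empty_Stack s b \<longleftrightarrow> b = None"

lemma accepting_iff_top: "accepting M m ([], z, s) \<longleftrightarrow> accepting_top M m s (last (bottomed z))"
  by (cases m; cases z rule: rev_cases) auto

datatype ('s, 'a) lookahead_state =
  Starting | Waiting 's | Holding 's 'a | Ending 's | Accepted | Rejected

instance lookahead_state :: (countable, countable) countable
  by countable_datatype

text \<open>
  An automaton may move silently after its last letter, possibly forever, so that it cannot be made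
  to read an end letter when it is about to accept.  Therefore the simulation postpones silent
  moves: it fetches the next letter first, and runs the silent moves with this letter in its state.
  Once the end letter has been fetched, it only has to wait for the simulated automaton to accept.
\<close>

fun lookahead_action ::
  "('a, 'b, 's) dpda \<Rightarrow> acceptance_mode \<Rightarrow> ('c \<Rightarrow> 'a option) \<Rightarrow>
     ('s, 'a) lookahead_state \<Rightarrow> 'b option \<Rightarrow> ('c, 'b option, ('s, 'a) lookahead_state) action" where
  "lookahead_action M m h Starting b = Silent (Waiting (start_state M), [b, Some (start_sym M)])"
| "lookahead_action M m h (Waiting s) b =
     Read (\<lambda>x. (case h x of None \<Rightarrow> Ending s | Some a \<Rightarrow> Holding s a, [b]))"
| "lookahead_action M m h (Holding s a) None = Silent (Rejected, [None])"
| "lookahead_action M m h (Holding s a) (Some b) =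
     Silent (case trans M None b s of
       Some (t, \<alpha>) \<Rightarrow> (Holding t a, map Some \<alpha>)
     | None \<Rightarrow> (case trans M (Some a) b s of
         Some (t, \<alpha>) \<Rightarrow> (Waiting t, map Some \<alpha>)
       | None \<Rightarrow> (Rejected, [Some b])))"
| "lookahead_action M m h (Ending s) b =
     Silent (if accepting_top M m s b then (Accepted, [b])
       else (case b of None \<Rightarrow> (Rejected, [b]) | Some b' \<Rightarrow> (case trans M None b' s of
         Some (t, \<alpha>) \<Rightarrow> (Ending t, map Some \<alpha>)
       | None \<Rightarrow> (Rejected, [b]))))"
| "lookahead_action M m h Accepted b = Read (\<lambda>_. (Accepted, [b]))"
| "lookahead_action M m h Rejected b = Read (\<lambda>_. (Rejected, [b]))"

context
  fixes M :: "('a, 'b, 's) dpda" and m :: acceptance_mode and h :: "'c \<Rightarrow> 'a option" and A :: "'c set"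
  assumes M: "is_dpda M" and A: "finite A" and h: "h ` A \<subseteq> insert None (Some ` inputs M)"
begin

definition lookahead_states :: "('s, 'a) lookahead_state set" where
  "lookahead_states = Waiting ` states M \<union> case_prod Holding ` (states M \<times> inputs M) \<union>
     Ending ` states M \<union> {Starting, Accepted, Rejected}"

definition lookahead :: "('c, 'b option, ('s, 'a) lookahead_state) dpda" where
  "lookahead = machine A (insert None (Some ` stack_syms M)) lookahead_states
     (lookahead_action M m h) Starting None {Accepted}"


lemma lookahead_states_iff [simp]:
  "Starting \<in> lookahead_states" "Accepted \<in> lookahead_states" "Rejected \<in> lookahead_states"
  "Waiting s \<in> lookahead_states \<longleftrightarrow> s \<in> states M"
  "Ending s \<in> lookahead_states \<longleftrightarrow> s \<in> states M"
  "Holding s a \<in> lookahead_states \<longleftrightarrow> s \<in> states M \<and> a \<in> inputs M"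
  by (auto simp: lookahead_states_def)

lemma is_dpda_lookahead: "is_dpda lookahead"
proof -
  have h_inputs: "a \<in> inputs M" if "x \<in> A" "h x = Some a" for x a
    using h that by force
  have trans: "t \<in> states M \<and> map Some \<alpha> \<in> lists (insert None (Some ` stack_syms M))"
    if "trans M x b s = Some (t, \<alpha>)" for x b s t \<alpha>
    using is_dpda_trans_closed[OF M that] by auto
  show ?thesis
    unfolding lookahead_def
  proof (rule is_dpda_machine)
    show "finite lookahead_states" "finite (insert None (Some ` stack_syms M))"
      using is_dpdaD[OF M] by (auto simp: lookahead_states_def)
  next
    fix s b assume "s \<in> lookahead_states" "b \<in> insert None (Some ` stack_syms M)"
    then show "action_within A (insert None (Some ` stack_syms M)) lookahead_states
      (lookahead_action M m h s b)"
      using is_dpdaD[OF M]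
      by (cases s; cases b) (auto split: option.splits dest: h_inputs trans)
  qed (use A in auto)
qed

lemma lookahead_step:
  assumes "s \<in> lookahead_states" "b \<in> insert None (Some ` stack_syms M)"
  shows "lookahead_action M m h s b = Silent (t, \<alpha>) \<Longrightarrow>
      accepts lookahead Final_State (u, z @ \<alpha>, t) \<Longrightarrow> accepts lookahead Final_State (u, z @ [b], s)"
    and "lookahead_action M m h s b = Read f \<Longrightarrow> f a = (t, \<alpha>) \<Longrightarrow> a \<in> A \<Longrightarrow>
      accepts lookahead Final_State (u, z @ \<alpha>, t) \<Longrightarrow> accepts lookahead Final_State (a # u, z @ [b], s)"
  using assms unfolding lookahead_def
  by (blast intro: accepts_step machine_step_silent machine_step_read)+

lemma bottomed_top:
  assumes "z \<in> lists (stack_syms M)"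
  obtains y b where "bottomed z = y @ [b]" "b \<in> insert None (Some ` stack_syms M)"
  using assms that by (cases z rule: rev_cases) auto

lemma lookahead_accepted:
  assumes "p \<in> lists A" "b \<in> insert None (Some ` stack_syms M)"
  shows "accepts lookahead Final_State (p, y @ [b], Accepted)"
  using assms(1)
proof (induction p)
  case Nil
  then show ?case by (intro accepts_accepting) (simp add: lookahead_def)
next
  case (Cons x p)
  then show ?case using lookahead_step(2)[of Accepted b _ x Accepted "[b]"] assms(2) by simp
qed

text \<open>
  If \<^term>\<open>M\<close> accepts from a configuration with unread word \<open>w\<close>, the simulation accepts from the
  corresponding configuration in which the first letter of \<open>w\<close>, or the end letter, has already been
  fetched.
\<close>

fun lookahead_accepts :: "'a list \<Rightarrow> 'b list \<Rightarrow> 's \<Rightarrow> bool" where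
  "lookahead_accepts [] z s \<longleftrightarrow>
     (\<forall>r\<in>lists A. accepts lookahead Final_State (r, bottomed z, Ending s))"
| "lookahead_accepts (a # w) z s \<longleftrightarrow>
     (\<forall>p\<in>lists A. \<forall>r. map h p = map Some w @ None # r \<longrightarrow>
        accepts lookahead Final_State (p, bottomed z, Holding s a))"

lemma lookahead_accepts_Waiting:
  assumes "lookahead_accepts w z s" "p \<in> lists A" "map h p = map Some w @ None # r"
    "z \<in> lists (stack_syms M)" "s \<in> states M"
  shows "accepts lookahead Final_State (p, bottomed z, Waiting s)"
proof -
  obtain y b where b: "bottomed z = y @ [b]" "b \<in> insert None (Some ` stack_syms M)"
    using bottomed_top[OF assms(4)] .
  obtain x q where p: "p = x # q" using assms(3) by (cases p) auto
  show ?thesis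
    using assms p b lookahead_step(2)[of "Waiting s" b _ x _ "[b]" q y]
    by (cases w) auto
qed

text \<open>
  A run of \<^term>\<open>M\<close> is mirrored step by step.  When \<^term>\<open>M\<close> reads a letter, the simulation holding
  this letter does the same, because determinism excludes a silent move of \<^term>\<open>M\<close>.
\<close>

lemma lookahead_complete:
  assumes "accepts M m (w, z, s)"
    and "w \<in> lists (inputs M)" "z \<in> lists (stack_syms M)" "s \<in> states M"
  shows "lookahead_accepts w z s"
  using assms
proof (induction rule: accepts_induct)
  case (accepting u z s)
  obtain y b where b: "bottomed z = y @ [b]" "b \<in> insert None (Some ` stack_syms M)"
    using bottomed_top[OF accepting(3)] .
  have "u = []" using accepting(1) by (cases m) auto
  moreover from this have "accepting_top M m s b"
    using accepting(1) b by (simp add: accepting_iff_top)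
  ultimately show ?case
    using b accepting lookahead_step(1)[of "Ending s" b Accepted "[b]"]
    by (simp add: lookahead_accepted)
next
  case (step u z s v z' t)
  note closed = dpda_step_closed[OF M step.hyps(1) step.prems(1,2)]
  have IH: "lookahead_accepts v z' t" by (rule step.IH[OF closed(2-4)])
  obtain y b where z: "z = y @ [b]" using step.hyps(1) by (cases z rule: rev_cases) auto
  have b: "b \<in> stack_syms M" using step.prems(2) z by simp
  from step.hyps(1) z obtain \<alpha> where z': "z' = y @ \<alpha>" and
    "trans M None b s = Some (t, \<alpha>) \<and> v = u \<or> (\<exists>a. trans M (Some a) b s = Some (t, \<alpha>) \<and> u = a # v)"
    by (auto simp: dpda_step_snoc)
  then consider "trans M None b s = Some (t, \<alpha>)" "v = u"
    | a where "trans M (Some a) b s = Some (t, \<alpha>)" "u = a # v" by blast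
  then show ?case
  proof cases
    case 1
    show ?thesis
    proof (cases u)
      case Nil
      have "accepts lookahead Final_State (r, bottomed z, Ending s)" if "r \<in> lists A" for r
      proof (cases "accepting_top M m s (Some b)")
        case True
        then show ?thesis
          using lookahead_step(1)[of "Ending s" "Some b" Accepted "[Some b]" r "bottomed y"]
            that z b step.prems lookahead_accepted by simp
      next
        case False
        then show ?thesis
          using lookahead_step(1)[of "Ending s" "Some b" "Ending t" "map Some \<alpha>" r "bottomed y"]
            that z z' b step.prems 1 IH Nil by simp
      qed
      then show ?thesis using Nil by simp
    next
      case (Cons a w)
      have "accepts lookahead Final_State (p, bottomed z, Holding s a)"
        if "p \<in> lists A" "map h p = map Some w @ None # r" for p r
        using lookahead_step(1)[of "Holding s a" "Some b" "Holding t a" "map Some \<alpha>" p "bottomed y"]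
          that z z' b step.prems 1 IH Cons by simp
      then show ?thesis using Cons by simp
    qed
  next
    case (2 a)
    have silent: "trans M None b s = None"
      using is_dpda_reads_iff[OF M b closed(1), of a] 2 step.prems by simp
    have "accepts lookahead Final_State (p, bottomed z, Holding s a)"
      if "p \<in> lists A" "map h p = map Some v @ None # r" for p r
      using lookahead_step(1)[of "Holding s a" "Some b" "Waiting t" "map Some \<alpha>" p "bottomed y"]
        lookahead_accepts_Waiting[OF IH that closed(3,4)] that z z' b step.prems 2 silent by simp
    then show ?thesis using 2 by simp
  qed
qed

lemma lookahead_sound:
  assumes "accepts lookahead Final_State (p, y, q)" and "y = bottomed z"
  shows "case q of
      Starting \<Rightarrow> True
    | Waiting s \<Rightarrow> \<exists>w r. map h p = map Some w @ None # r \<and> accepts M m (w, z, s)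
    | Holding s a \<Rightarrow> \<exists>w r. map h p = map Some w @ None # r \<and> accepts M m (a # w, z, s)
    | Ending s \<Rightarrow> accepts M m ([], z, s)
    | Accepted \<Rightarrow> True
    | Rejected \<Rightarrow> False"
  using assms
proof (induction arbitrary: z rule: accepts_induct)
  case (accepting u z' s)
  then show ?case by (auto simp: lookahead_def)
next
  case (step p y q p' y' q')
  obtain x b where y: "y = x @ [b]" using step.hyps(1) by (cases y rule: rev_cases) auto
  note st = step.hyps(1)[unfolded y lookahead_def machine_step]
  show ?case
  proof (cases q)
    case (Waiting s)
    with st obtain a where a: "p = a # p'" "y' = y"
      "q' = (case h a of None \<Rightarrow> Ending s | Some a \<Rightarrow> Holding s a)"
      using y by auto
    show ?thesis
    proof (cases "h a")
      case None
      then show ?thesis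
        using step.IH[of z] step.prems a Waiting by auto
    next
      case (Some c)
      then obtain w r where "map h p' = map Some w @ None # r" "accepts M m (c # w, z, s)"
        using step.IH[of z] step.prems a by auto
      then show ?thesis using a Some Waiting by (auto intro!: exI[of _ "c # w"])
    qed
  next
    case (Holding s a)
    have "b \<noteq> None" using st step.IH[of z] step.prems y Holding by auto
    then obtain c z1 where z: "z = z1 @ [c]" "b = Some c" "x = bottomed z1"
      using step.prems y by (cases z rule: rev_cases) auto
    have "(\<exists>t \<alpha>. trans M None c s = Some (t, \<alpha>) \<and> p' = p \<and> y' = bottomed (z1 @ \<alpha>) \<and> q' = Holding t a) \<or>
      (\<exists>t \<alpha>. trans M (Some a) c s = Some (t, \<alpha>) \<and> p' = p \<and> y' = bottomed (z1 @ \<alpha>) \<and> q' = Waiting t)"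
      using st z Holding step.IH[of z] y step.prems by (auto split: option.splits)
    then show ?thesis
    proof (elim disjE exE conjE)
      fix t \<alpha> assume *: "trans M None c s = Some (t, \<alpha>)" "p' = p" "y' = bottomed (z1 @ \<alpha>)" "q' = Holding t a"
      then obtain w r where w: "map h p = map Some w @ None # r" and "accepts M m (a # w, z1 @ \<alpha>, t)"
        using step.IH[of "z1 @ \<alpha>"] by auto
      moreover have "dpda_step M (a # w, z, s) (a # w, z1 @ \<alpha>, t)"
        using * z by (auto simp: dpda_step_snoc)
      ultimately have "accepts M m (a # w, z, s)" by (blast intro: accepts_step)
      then show ?thesis using Holding w by auto
    next
      fix t \<alpha> assume *: "trans M (Some a) c s = Some (t, \<alpha>)" "p' = p" "y' = bottomed (z1 @ \<alpha>)" "q' = Waiting t"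
      then obtain w r where w: "map h p = map Some w @ None # r" and "accepts M m (w, z1 @ \<alpha>, t)"
        using step.IH[of "z1 @ \<alpha>"] by auto
      moreover have "dpda_step M (a # w, z, s) (w, z1 @ \<alpha>, t)"
        using * z by (auto simp: dpda_step_snoc)
      ultimately have "accepts M m (a # w, z, s)" by (blast intro: accepts_step)
      then show ?thesis using Holding w by auto
    qed
  next
    case (Ending s)
    show ?thesis
    proof (cases "accepting_top M m s b")
      case True
      then have "accepting M m ([], z, s)" using y step.prems by (simp add: accepting_iff_top)
      then show ?thesis using Ending by (simp add: accepts_accepting)
    next
      case False
      then have "b \<noteq> None" using st step.IH[of z] step.prems y Ending by auto
      then obtain c z1 where z: "z = z1 @ [c]" "b = Some c" "x = bottomed z1"
        using step.prems y by (cases z rule: rev_cases) auto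
      then obtain t \<alpha> where *: "trans M None c s = Some (t, \<alpha>)" "y' = bottomed (z1 @ \<alpha>)" "q' = Ending t"
        using st Ending step.IH[of z] y step.prems False by (auto split: option.splits)
      have "dpda_step M ([], z, s) ([], z1 @ \<alpha>, t)" using * z by (auto simp: dpda_step_snoc)
      moreover have "accepts M m ([], z1 @ \<alpha>, t)" using * step.IH[of "z1 @ \<alpha>"] by simp
      ultimately show ?thesis using Ending by (auto intro: accepts_step)
    qed
  next
    case Rejected
    then show ?thesis using st step.IH[of z] y step.prems by auto
  qed auto
qed

lemma lookahead_lang:
  "dpda_lang lookahead Final_State =
     {p \<in> lists A. \<exists>w\<in>dpda_lang M m. \<exists>r. map h p = map Some w @ None # r}"
proof -
  have "accepts lookahead Final_State (p, [None], Starting) \<longleftrightarrow>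
    (\<exists>w\<in>dpda_lang M m. \<exists>r. map h p = map Some w @ None # r)" if p: "p \<in> lists A" for p
  proof
    assume "accepts lookahead Final_State (p, [None], Starting)"
    then have "accepts lookahead Final_State (p, bottomed [start_sym M], Waiting (start_state M))"
      by (cases rule: accepts_cases)
        (auto simp: bottomed_def lookahead_def machine_step[where z = "[]", simplified])
    then obtain w r where w: "map h p = map Some w @ None # r"
        "accepts M m (w, [start_sym M], start_state M)"
      using lookahead_sound by fastforce
    have "set (map h p) \<subseteq> insert None (Some ` inputs M)" using p h by auto
    then have "w \<in> lists (inputs M)" using w(1) by auto
    then show "\<exists>w\<in>dpda_lang M m. \<exists>r. map h p = map Some w @ None # r"
      using w by (auto simp: dpda_lang_accepts)
  next
    assume "\<exists>w\<in>dpda_lang M m. \<exists>r. map h p = map Some w @ None # r"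
    then obtain w r where w: "map h p = map Some w @ None # r" "w \<in> lists (inputs M)"
        "accepts M m (w, [start_sym M], start_state M)"
      by (auto simp: dpda_lang_accepts)
    have "accepts lookahead Final_State (p, bottomed [start_sym M], Waiting (start_state M))"
      using lookahead_accepts_Waiting[OF lookahead_complete[OF w(3,2)] p w(1)] is_dpdaD[OF M] by simp
    then show "accepts lookahead Final_State (p, [None], Starting)"
      using lookahead_step(1)[of Starting None "Waiting (start_state M)" _ p "[]"]
      by (simp add: bottomed_def)
  qed
  then show ?thesis by (auto simp: dpda_lang_accepts) (auto simp: lookahead_def)
qed

end

text \<open>
  The first letter that \<open>h\<close> maps to \<^term>\<open>None\<close> ends the prefix, whatever follows it.
\<close>

definition cuts_to :: "('c \<Rightarrow> 'a option) \<Rightarrow> 'c list \<Rightarrow> 'a list \<Rightarrow> bool" where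
  "cuts_to h p w \<longleftrightarrow> (\<exists>r. map h p = map Some w @ None # r)"

lemma is_dpda_language_prefix:
  fixes h :: "'c \<Rightarrow> ('a::countable) option"
  assumes "is_dpda_language A K" "finite B" "h ` B \<subseteq> insert None (Some ` A)"
  shows "is_dpda_language B {p \<in> lists B. \<exists>w\<in>K. cuts_to h p w}"
proof -
  obtain M :: "('a, nat, nat) dpda" and m where M: "is_dpda M" "inputs M = A" "K = dpda_lang M m"
    using assms(1) by (auto simp: is_dpda_language_def)
  have h: "h ` B \<subseteq> insert None (Some ` inputs M)" using assms(3) M(2) by simp
  show ?thesis
    using is_dpda_language_of_countable[OF is_dpda_lookahead[OF M(1) assms(2) h, of m], of Final_State]
    by (simp add: lookahead_lang[OF M(1) assms(2) h] M(3) cuts_to_def)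
      (simp add: lookahead_def[OF M(1) assms(2) h])
qed

section \<open>Reading the two tapes one after the other\<close>

lemma end_marked_simps [simp]:
  "end_marked [] = [None]" "end_marked (a # u) = Some a # end_marked u" "end_marked u \<noteq> []"
  "[] \<noteq> end_marked u"
  by (simp_all add: end_marked_def)

lemma end_marked_eq_iff [simp]: "end_marked u = end_marked v \<longleftrightarrow> u = v"
  by (simp add: end_marked_def inj_map_eq_map)

lemma tape_alphabet_iff [simp]:
  "Inl x \<in> tape_alphabet A \<longleftrightarrow> x \<in> insert None (Some ` A)"
  "Inr x \<in> tape_alphabet A \<longleftrightarrow> x \<in> insert None (Some ` A)"
  by (auto simp: tape_alphabet_def)

lemma finite_tape_alphabet [simp]: "finite A \<Longrightarrow> finite (tape_alphabet A)"
  by (simp add: tape_alphabet_def)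

fun untape :: "'a tape_letter \<Rightarrow> 'a option" where
  "untape (Inl x) = x"
| "untape (Inr x) = x"

lemma untape_in [simp]: "x \<in> tape_alphabet A \<Longrightarrow> untape x \<in> insert None (Some ` A)"
  by (cases x) auto

fun sequential_action ::
  "('a option, 'b, 's) dpda \<Rightarrow> 's \<times> bool \<Rightarrow> 'b \<Rightarrow> ('a tape_letter, 'b, 's \<times> bool) action" where
  "sequential_action M (s, second) b = (case trans M None b s of
     Some (t, \<alpha>) \<Rightarrow> Silent ((t, second), \<alpha>)
   | None \<Rightarrow> Read (\<lambda>x. case trans M (Some (untape x)) b s of
       Some (t, \<alpha>) \<Rightarrow> ((t, second \<or> untape x = None), \<alpha>)
     | None \<Rightarrow> ((s, second), [])))"

context
  fixes M :: "('a option, 'b, 's) dpda" and m :: acceptance_mode and A :: "'a set"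
  assumes M: "is_dpda M" and inputs: "inputs M = insert None (Some ` A)" and A: "finite A"
begin

definition sequential :: "('a tape_letter, 'b, 's \<times> bool) dpda" where
  "sequential = machine (tape_alphabet A) (stack_syms M) (states M \<times> UNIV)
     (sequential_action M) (start_state M, False) (start_sym M) (final_states M \<times> UNIV)"

abbreviation (input) "sequential_tapes \<equiv> with_tapes sequential (\<lambda>(s, second). \<not> second)"

lemma is_dpda_sequential: "is_dpda sequential"
  unfolding sequential_def
proof (rule is_dpda_machine)
  fix q b assume *: "q \<in> states M \<times> (UNIV :: bool set)" "b \<in> stack_syms M"
  have trans: "t \<in> states M \<and> \<alpha> \<in> lists (stack_syms M)"
    if "trans M x b s = Some (t, \<alpha>)" for x b s t \<alpha>
    using is_dpda_trans_closed[OF M that] by auto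
  show "action_within (tape_alphabet A) (stack_syms M) (states M \<times> UNIV) (sequential_action M q b)"
    using * by (cases q) (auto split: option.splits dest: trans)
qed (use is_dpdaD[OF M] A in auto)

lemma sequential_complete:
  assumes "accepts M m (x, z, s)" "x = u @ v"
    "if second then u = [] else \<exists>u'. u = end_marked u'"
  shows "pair_accepts sequential_tapes m (u, v, z, (s, second))"
  using assms
proof (induction arbitrary: u v second rule: accepts_induct)
  case (accepting x z s)
  have x: "x = []" using accepting.hyps by (cases m) auto
  then have "second" using accepting by (cases second) auto
  moreover have "accepting sequential_tapes m ([], z, s, True)"
    using accepting x by (cases m) (auto simp: sequential_def)
  ultimately show ?case using accepting x by (auto intro: pair_accepts_accepting)
next
  case (step x z s x' z' t)
  obtain y b where z: "z = y @ [b]" using step.hyps(1) by (cases z rule: rev_cases) auto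
  from step.hyps(1) z obtain \<alpha> where z': "z' = y @ \<alpha>" and
    "trans M None b s = Some (t, \<alpha>) \<and> x' = x \<or> (\<exists>a. trans M (Some a) b s = Some (t, \<alpha>) \<and> x = a # x')"
    by (auto simp: dpda_step_snoc)
  then consider "trans M None b s = Some (t, \<alpha>)" "x' = x"
    | a where "trans M (Some a) b s = Some (t, \<alpha>)" "x = a # x'" by blast
  then show ?case
  proof cases
    case 1
    have "pair_step sequential_tapes (u, v, z, s, second) (u, v, z', t, second)"
      unfolding z z' sequential_def
      by (rule with_tapes_step_silent) (use 1 is_dpda_trans_closed[OF M 1(1)] in auto)
    then show ?thesis using step.IH[of u v second] step.prems 1 by (auto intro: pair_accepts_step)
  next
    case (2 a)
    note closed = is_dpda_trans_closed[OF M 2(1)]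
    have silent: "trans M None b s = None"
      using is_dpda_reads_iff[OF M closed(2,3), of a] 2(1) closed(1) by auto
    show ?thesis
    proof (cases second)
      case True
      then have v: "u = []" "v = a # x'" using step.prems 2 by auto
      have "pair_step sequential_tapes (u, v, z, s, second) (u, x', z', t, True)"
        using True silent 2 closed inputs z z' v by (auto simp: sequential_def with_tapes_step)
      then show ?thesis using step.IH[of "[]" x' True] v by (auto intro: pair_accepts_step)
    next
      case False
      then obtain u' where "u = end_marked u'" using step.prems by auto
      then obtain u'' where u: "u = a # u''" "x' = u'' @ v"
        "if a = None then u'' = [] else \<exists>u'. u'' = end_marked u'"
        using step.prems(1) 2(2) by (cases u') auto
      have "pair_step sequential_tapes (u, v, z, s, second) (u'', v, z', t, a = None)"
        using False silent 2 closed inputs z z' u(1) by (auto simp: sequential_def with_tapes_step)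
      then show ?thesis using step.IH[of u'' v "a = None"] u by (auto intro: pair_accepts_step)
    qed
  qed
qed

lemma sequential_sound:
  assumes "pair_accepts sequential_tapes m (u, v, z, q)" "q = (s, second)"
  shows "accepts M m (u @ v, z, s) \<and> (second \<longrightarrow> u = [])"
  using assms
proof (induction arbitrary: s second rule: pair_accepts_induct)
  case (accepting z q)
  then have "accepting M m ([], z, s)" by (cases m) (auto simp: sequential_def)
  then show ?case by (auto intro: accepts_accepting)
next
  case (step u v z q u' v' z' q')
  obtain y b where z: "z = y @ [b]" using step.hyps(1) by (cases z rule: rev_cases) auto
  obtain t second' where q': "q' = (t, second')" by (cases q')
  note st = step.hyps(1)[unfolded z step.prems q' sequential_def with_tapes_step]
  have mem: "b \<in> stack_syms M" "s \<in> states M" using st by auto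
  show ?case
  proof (cases "trans M None b s")
    case (Some p)
    then have "dpda_step M (u @ v, z, s) (u' @ v', z', t)" "second = second'" "u' = u"
      using st z by (cases p; auto simp: dpda_step_snoc)+
    then show ?thesis using step.IH[OF q'] by (auto intro: accepts_step)
  next
    case None
    have reads: "trans M (Some a) b s \<noteq> None" if "a \<in> insert None (Some ` A)" for a
      using is_dpda_reads_iff[OF M mem, of a] that None inputs by simp
    show ?thesis
    proof (cases second)
      case True
      then obtain a where a: "a \<in> insert None (Some ` A)" "v = a # v'" "u' = u"
        using st None by auto
      obtain t1 \<alpha> where t1: "trans M (Some a) b s = Some (t1, \<alpha>)" using reads[OF a(1)] by auto
      have "z' = y @ \<alpha>" "t = t1" "second'" using st None True a t1 by auto
      then have "dpda_step M (v, z, s) (v', z', t)" using a z t1 by (auto simp: dpda_step_snoc)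
      then show ?thesis using step.IH[OF q'] \<open>second'\<close> a by (auto intro: accepts_step)
    next
      case False
      then obtain a where a: "a \<in> insert None (Some ` A)" "u = a # u'" "v' = v"
        using st None by auto
      obtain t1 \<alpha> where t1: "trans M (Some a) b s = Some (t1, \<alpha>)" using reads[OF a(1)] by auto
      have "z' = y @ \<alpha>" "t = t1" using st None False a t1 by auto
      then have "dpda_step M (u @ v, z, s) (u' @ v', z', t)" using a z t1 by (auto simp: dpda_step_snoc)
      then show ?thesis using step.IH[OF q'] False by (auto intro: accepts_step)
    qed
  qed
qed

lemma sequential_lang:
  "two_tape_lang A sequential_tapes m =
     {(u, v). u \<in> lists A \<and> v \<in> lists A \<and> end_marked u @ end_marked v \<in> dpda_lang M m}"
proof -
  have "end_marked u \<in> lists (inputs M)" if "u \<in> lists A" for u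
    using that inputs by (auto simp: end_marked_def)
  moreover have "pair_accepts sequential_tapes m (end_marked u, end_marked v, [start_sym M], (start_state M, False))
    \<longleftrightarrow> accepts M m (end_marked u @ end_marked v, [start_sym M], start_state M)" for u v
    using sequential_sound[of "end_marked u" "end_marked v" "[start_sym M]" _ "start_state M" False]
      sequential_complete[of _ "[start_sym M]" "start_state M" "end_marked u" "end_marked v" False]
    by auto
  moreover have "start_sym sequential = start_sym M" "start_state sequential = (start_state M, False)"
    by (simp_all add: sequential_def)
  ultimately show ?thesis
    by (auto simp: two_tape_lang_pair_accepts dpda_lang_accepts)
qed

end

text \<open>
  The partition of the states can impose that all of the first tape is read before the second one,
  so every one-tape automaton for words \<open>u$v$\<close> gives a two-tape automaton.
\<close>

lemma is_two_tape_language_sequential: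
  assumes "is_dpda_language (insert None (Some ` A)) D" "finite A"
  shows "is_two_tape_language A
    {(u, v). u \<in> lists A \<and> v \<in> lists A \<and> end_marked u @ end_marked v \<in> D}"
proof -
  obtain M :: "('a option, nat, nat) dpda" and m where M: "is_dpda M"
    "inputs M = insert None (Some ` A)" "D = dpda_lang M m"
    using assms(1) by (auto simp: is_dpda_language_def)
  have "inputs (sequential M A) = tape_alphabet A"
    by (simp add: sequential_def[OF M(1,2) assms(2)])
  then show ?thesis
    using is_two_tape_language_of_countable[OF is_dpda_sequential[OF M(1,2) assms(2)], of A
        "\<lambda>(s, second). \<not> second" m] sequential_lang[OF M(1,2) assms(2), of m] M(3)
    by simp
qed

section \<open>Comparing the two tapes\<close>

datatype 'a equality_state = Next | Expect "'a option" | Equal | Unequal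

instance equality_state :: (countable) countable
  by countable_datatype

fun equality_action :: "'a equality_state \<Rightarrow> unit \<Rightarrow> ('a tape_letter, unit, 'a equality_state) action" where
  "equality_action Next b = Read (\<lambda>x. (Expect (untape x), [b]))"
| "equality_action (Expect y) b = Read (\<lambda>x.
     (if untape x \<noteq> y then Unequal else if y = None then Equal else Next, [b]))"
| "equality_action Equal b = Read (\<lambda>_. (Unequal, [b]))"
| "equality_action Unequal b = Read (\<lambda>_. (Unequal, [b]))"

text \<open>
  The automaton reads the tapes alternately, letter by letter, and leaves its stack alone.
\<close>

lemma is_two_tape_language_diagonal:
  fixes A :: "('a::countable) set"
  assumes A: "finite A"
  shows "is_two_tape_language A {(u, v). u \<in> lists A \<and> u = v}"
proof -
  let ?S = "{Next, Equal, Unequal} \<union> Expect ` insert None (Some ` A)"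
  define M where "M = machine (tape_alphabet A) UNIV ?S equality_action Next () {Equal}"
  let ?T = "with_tapes M (\<lambda>s. s = Next)"
  have "action_within (tape_alphabet A) UNIV ?S (equality_action s b)" if "s \<in> ?S" for s b
    using that by (cases s) (auto dest: untape_in)
  then have M: "is_dpda M"
    unfolding M_def using A by (intro is_dpda_machine) auto
  have complete: "pair_accepts ?T Final_State (end_marked u, end_marked u, [()], Next)"
    if "u \<in> lists A" for u
    using that
  proof (induction u)
    case Nil
    have "pair_step ?T ([None], [None], [()], Next) ([], [None], [()], Expect None)"
      "pair_step ?T ([], [None], [()], Expect None) ([], [], [()], Equal)"
      by (simp_all add: M_def with_tapes_step[where z = "[]", simplified])
    moreover have "pair_accepts ?T Final_State ([], [], [()], Equal)"
      by (rule pair_accepts_accepting) (simp add: M_def)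
    ultimately show ?case by (auto intro: pair_accepts_step)
  next
    case (Cons a u)
    have "pair_step ?T (end_marked (a # u), end_marked (a # u), [()], Next)
        (end_marked u, end_marked (a # u), [()], Expect (Some a))"
      "pair_step ?T (end_marked u, end_marked (a # u), [()], Expect (Some a))
        (end_marked u, end_marked u, [()], Next)"
      using Cons.hyps by (auto simp: M_def with_tapes_step[where z = "[]", simplified])
    then show ?case using Cons by (auto intro: pair_accepts_step)
  qed
  have sound: "case s of Expect a \<Rightarrow> v = a # u | Unequal \<Rightarrow> False | _ \<Rightarrow> u = v"
    if "pair_accepts ?T Final_State (u, v, z, s)" for u v z s
    using that
  proof (induction rule: pair_accepts_induct)
    case (accepting z s)
    then show ?case by (simp add: M_def)
  next
    case (step u v z s u' v' z' t)
    obtain y b where z: "z = y @ [b]" using step.hyps(1) by (cases z rule: rev_cases) auto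
    show ?case
      using step.hyps(1) step.IH unfolding z M_def with_tapes_step
      by (cases s) (auto split: if_splits)
  qed
  have "pair_accepts ?T Final_State (end_marked u, end_marked v, [start_sym ?T], start_state ?T)
      \<longleftrightarrow> u = v" if "u \<in> lists A" for u v
    using complete[OF that] sound[of "end_marked u" "end_marked v" "[()]" Next]
    by (auto simp: M_def)
  then have "two_tape_lang A ?T Final_State = {(u, v). u \<in> lists A \<and> u = v}"
    unfolding two_tape_lang_pair_accepts by blast
  then show ?thesis
    using is_two_tape_language_of_countable[OF M, of A "\<lambda>s. s = Next" Final_State]
    by (simp add: M_def)
qed

section \<open>Cutting off prefixes on both tapes\<close>

datatype 's cutting_state =
  Initial | Simulating 's bool bool | Sharp_Rest | Flat_Rest | Finished | Failed

instance cutting_state :: (countable) countable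
  by countable_datatype

text \<open>
  The two truth values record which tapes have delivered their end letter to the simulated
  automaton; reading such a tape once more fails, just as the simulated automaton gets stuck on an
  exhausted tape.  After the simulation the remainders of both tapes are consumed.  No lookahead is
  needed here: the simulated automaton reads an end marker itself, and the first letter that
  \<open>h\<close> maps to \<^term>\<open>None\<close> is passed to it as this marker.
\<close>

fun cutting_action ::
  "('a, 'b, 's) two_tape \<Rightarrow> acceptance_mode \<Rightarrow> ('c \<Rightarrow> 'a option) \<Rightarrow>
     's cutting_state \<Rightarrow> 'b option \<Rightarrow> ('c tape_letter, 'b option, 's cutting_state) action" where
  "cutting_action T m h Initial b =
     Silent (Simulating (start_state T) False False, [b, Some (start_sym T)])"
| "cutting_action T m h (Simulating s d e) b =
     (if d \<and> e \<and> accepting_top T m s b then Silent (Sharp_Rest, [b])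
      else case b of None \<Rightarrow> Silent (Failed, [b]) | Some c \<Rightarrow>
        (case trans T None c s of
           Some (t, \<alpha>) \<Rightarrow> Silent (Simulating t d e, map Some \<alpha>)
         | None \<Rightarrow> Read (\<lambda>x. case x of
             Inl (Some a) \<Rightarrow> (if d then (Failed, [b]) else
               (case trans T (Some (Inl (h a))) c s of
                  Some (t, \<alpha>) \<Rightarrow> (Simulating t (h a = None) e, map Some \<alpha>)
                | None \<Rightarrow> (Failed, [b])))
           | Inr (Some a) \<Rightarrow> (if e then (Failed, [b]) else
               (case trans T (Some (Inr (h a))) c s of
                  Some (t, \<alpha>) \<Rightarrow> (Simulating t d (h a = None), map Some \<alpha>)
                | None \<Rightarrow> (Failed, [b])))
           | _ \<Rightarrow> (Failed, [b]))))"
| "cutting_action T m h Sharp_Rest b =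
     Read (\<lambda>x. (if x = Inl None then Flat_Rest else Sharp_Rest, [b]))"
| "cutting_action T m h Flat_Rest b =
     Read (\<lambda>x. (if x = Inr None then Finished else Flat_Rest, [b]))"
| "cutting_action T m h Finished b = Read (\<lambda>_. (Failed, [b]))"
| "cutting_action T m h Failed b = Read (\<lambda>_. (Failed, [b]))"

fun cutting_sharp :: "('a, 'b, 's) two_tape \<Rightarrow> 's cutting_state \<Rightarrow> bool" where
  "cutting_sharp T (Simulating s d e) \<longleftrightarrow> s \<in> sharp_states T"
| "cutting_sharp T Sharp_Rest \<longleftrightarrow> True"
| "cutting_sharp T _ \<longleftrightarrow> False"

context
  fixes T :: "('a, 'b, 's) two_tape" and m :: acceptance_mode and h :: "'c \<Rightarrow> 'a option"
    and A :: "'a set" and B :: "'c set"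
  assumes T: "is_two_tape A T" and B: "finite B" and h: "h ` B \<subseteq> insert None (Some ` A)"
begin

text \<open>
  The unread part of a tape of the simulating automaton, related to the unread part of the
  corresponding tape of \<^term>\<open>T\<close>.
\<close>

inductive cut_tape :: "bool \<Rightarrow> 'a option list \<Rightarrow> 'c option list \<Rightarrow> bool" where
  ended: "r \<in> lists B \<Longrightarrow> cut_tape True [] (end_marked r)"
| letter: "x \<in> B \<Longrightarrow> cut_tape (h x = None) u p \<Longrightarrow> cut_tape False (h x # u) (Some x # p)"

lemma cut_tapeD:
  "cut_tape d u p \<Longrightarrow> if d then u = [] \<and> (\<exists>r\<in>lists B. p = end_marked r)
     else \<exists>u' p' r. u = end_marked u' \<and> p = end_marked p' \<and> p' \<in> lists B \<and>
       map h p' = map Some u' @ None # r"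
proof (induction rule: cut_tape.induct)
  case (letter x u p)
  show ?case
  proof (cases "h x")
    case None
    then obtain r where "u = []" "r \<in> lists B" "p = end_marked r" using letter.IH by auto
    then have "h x # u = end_marked [] \<and> Some x # p = end_marked (x # r) \<and> x # r \<in> lists B \<and>
        map h (x # r) = map Some [] @ None # map h r"
      using None letter.hyps by simp
    then show ?thesis by (simp only: if_False) blast
  next
    case (Some a)
    then obtain u' p' r where "u = end_marked u'" "p = end_marked p'" "p' \<in> lists B"
        "map h p' = map Some u' @ None # r"
      using letter.IH by auto
    then have "h x # u = end_marked (a # u') \<and> Some x # p = end_marked (x # p') \<and>
        x # p' \<in> lists B \<and> map h (x # p') = map Some (a # u') @ None # r"
      using Some letter.hyps by simp
    then show ?thesis by (simp only: if_False) blast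
  qed
qed auto

lemma cut_tape_end_marked:
  "p \<in> lists B \<Longrightarrow> map h p = map Some u @ None # r \<Longrightarrow>
     cut_tape False (end_marked u) (end_marked p)"
proof (induction p arbitrary: u)
  case (Cons x p)
  show ?case
  proof (cases u)
    case Nil
    then show ?thesis using Cons.prems letter[of x "[]" "end_marked p"] ended[of p] by auto
  next
    case (Cons a u')
    then show ?thesis
      using Cons.prems Cons.IH[of u'] letter[of x "end_marked u'" "end_marked p"] by auto
  qed
qed simp

definition cutting_states :: "'s cutting_state set" where
  "cutting_states = {Initial, Sharp_Rest, Flat_Rest, Finished, Failed} \<union>
     (\<lambda>(s, d, e). Simulating s d e) ` (states T \<times> UNIV)"

lemma cutting_states_iff [simp]:
  "Initial \<in> cutting_states" "Sharp_Rest \<in> cutting_states" "Flat_Rest \<in> cutting_states"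
  "Finished \<in> cutting_states" "Failed \<in> cutting_states"
  "Simulating s d e \<in> cutting_states \<longleftrightarrow> s \<in> states T"
  by (auto simp: cutting_states_def image_iff)

abbreviation "cutting_syms \<equiv> insert None (Some ` stack_syms T)"

definition cutting :: "('c tape_letter, 'b option, 's cutting_state) dpda" where
  "cutting = machine (tape_alphabet B) cutting_syms cutting_states
     (cutting_action T m h) Initial None {Finished}"

abbreviation "cutting_tapes \<equiv> with_tapes cutting (cutting_sharp T)"

lemma dpda_T: "is_dpda T" and inputs_T: "inputs T = tape_alphabet A"
  and sides_T: "s \<in> states T \<Longrightarrow> s \<in> flat_states T \<longleftrightarrow> s \<notin> sharp_states T"
  using T by (auto simp: is_two_tape_def)

lemma h_in: "x \<in> B \<Longrightarrow> h x \<in> insert None (Some ` A)"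
  using h by auto

lemma is_dpda_cutting: "is_dpda cutting"
  unfolding cutting_def
proof (rule is_dpda_machine)
  fix s b assume *: "s \<in> cutting_states" "b \<in> cutting_syms"
  have trans: "t \<in> states T \<and> map Some \<alpha> \<in> lists cutting_syms"
    if "trans T x b s = Some (t, \<alpha>)" for x b s t \<alpha>
    using is_dpda_trans_closed[OF dpda_T that] by auto
  show "action_within (tape_alphabet B) cutting_syms cutting_states (cutting_action T m h s b)"
    using * is_dpdaD[OF dpda_T]
    by (cases s; cases b) (auto split: option.splits sum.splits dest: trans)
qed (use is_dpdaD[OF dpda_T] B in \<open>auto simp: cutting_states_def\<close>)

lemma cutting_rest:
  assumes b: "b \<in> cutting_syms" and r: "r \<in> lists B"
  shows "pair_accepts cutting_tapes Final_State ([], end_marked r, y @ [b], Flat_Rest)"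
    and "r' \<in> lists B \<Longrightarrow>
      pair_accepts cutting_tapes Final_State (end_marked r', end_marked r, y @ [b], Sharp_Rest)"
proof -
  note step = pair_accepts_step[rotated, where T = cutting_tapes and m = Final_State]
  have fin: "pair_accepts cutting_tapes Final_State ([], [], y @ [b], Finished)"
    by (rule pair_accepts_accepting) (simp add: cutting_def)
  show flat: "pair_accepts cutting_tapes Final_State ([], end_marked r, y @ [b], Flat_Rest)"
    using r
  proof (induction r)
    case Nil
    show ?case by (rule step[OF fin]) (use b in \<open>simp add: cutting_def with_tapes_step\<close>)
  next
    case (Cons x r)
    show ?case
      by (rule step[OF Cons.IH]) (use b Cons.hyps in \<open>simp add: cutting_def with_tapes_step\<close>)
  qed
  show "pair_accepts cutting_tapes Final_State (end_marked r', end_marked r, y @ [b], Sharp_Rest)"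
    if "r' \<in> lists B"
    using that
  proof (induction r')
    case Nil
    show ?case by (rule step[OF flat]) (use b in \<open>simp add: cutting_def with_tapes_step\<close>)
  next
    case (Cons x r)
    show ?case
      by (rule step[OF Cons.IH]) (use b Cons.hyps in \<open>simp add: cutting_def with_tapes_step\<close>)
  qed
qed

lemma cutting_accepting:
  assumes "accepting T m ([], z, s)" "z \<in> lists (stack_syms T)" "s \<in> states T"
    and "cut_tape True u p" "cut_tape True v q"
  shows "pair_accepts cutting_tapes Final_State (p, q, bottomed z, Simulating s True True)"
proof -
  obtain y b where b: "bottomed z = y @ [b]" "b \<in> cutting_syms"
    using assms(2) by (cases z rule: rev_cases) auto
  then have "accepting_top T m s b" using assms(1) by (simp add: accepting_iff_top)
  then have "pair_step cutting_tapes (p, q, bottomed z, Simulating s True True)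
      (p, q, y @ [b], Sharp_Rest)"
    using b assms(3) by (simp add: cutting_def with_tapes_step)
  moreover obtain r r' where "p = end_marked r" "q = end_marked r'" "r \<in> lists B" "r' \<in> lists B"
    using cut_tapeD[OF assms(4)] cut_tapeD[OF assms(5)] by auto
  ultimately show ?thesis using cutting_rest(2)[OF b(2)] by (auto intro: pair_accepts_step)
qed

lemma cutting_complete:
  assumes "pair_accepts T m (u, v, z, s)" "z \<in> lists (stack_syms T)" "s \<in> states T"
    "cut_tape d u p" "cut_tape e v q"
  shows "pair_accepts cutting_tapes Final_State (p, q, bottomed z, Simulating s d e)"
  using assms
proof (induction arbitrary: d e p q rule: pair_accepts_induct)
  case (accepting z s)
  then show ?case
    using cutting_accepting[of z s "[]" p "[]" q] cut_tapeD[of d "[]" p] cut_tapeD[of e "[]" q]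
    by (auto split: if_splits)
next
  case (step u v z s u' v' z' t)
  obtain y b where z: "z = y @ [b]" using step.hyps(1) by (cases z rule: rev_cases) auto
  show ?case
  proof (cases "d \<and> e \<and> accepting_top T m s (Some b)")
    case True
    then have "accepting T m ([], z, s)" using z by (simp add: accepting_iff_top)
    then show ?thesis
      using cutting_accepting[of z s u p v q] step.prems True by simp
  next
    case False
    from step.hyps(1) z obtain \<alpha> x where z': "z' = y @ \<alpha>" and tr: "trans T x b s = Some (t, \<alpha>)"
      and x: "x = None \<and> u' = u \<and> v' = v \<or>
        (\<exists>a. x = Some (Inl a) \<and> s \<in> sharp_states T \<and> u = a # u' \<and> v' = v) \<or>
        (\<exists>a. x = Some (Inr a) \<and> s \<in> flat_states T \<and> u' = u \<and> v = a # v')"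
      unfolding z pair_step_snoc by blast
    note closed = is_dpda_trans_closed[OF dpda_T tr]
    have z'_in: "z' \<in> lists (stack_syms T)" using step.prems(1) closed(5) z z' by auto
    have silent: "trans T None b s = None" if "x \<noteq> None"
      using is_dpda_reads_iff[OF dpda_T closed(2,3)] tr closed(1) that by auto
    from x show ?thesis
    proof (elim disjE exE conjE)
      assume *: "x = None" "u' = u" "v' = v"
      then have "pair_accepts cutting_tapes Final_State (p, q, bottomed z', Simulating t d e)"
        using step.IH[OF z'_in closed(4), of d p e q] step.prems by simp
      moreover have "pair_step cutting_tapes (p, q, bottomed z, Simulating s d e)
          (p, q, bottomed z', Simulating t d e)"
        using * tr closed False by (auto simp: z z' cutting_def with_tapes_step)
      ultimately show ?thesis by (rule pair_accepts_step[rotated])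
    next
      fix a assume *: "x = Some (Inl a)" "s \<in> sharp_states T" "u = a # u'" "v' = v"
      from step.prems(3) obtain c p' where c: "\<not> d" "p = Some c # p'" "a = h c" "c \<in> B"
        "cut_tape (a = None) u' p'"
        unfolding *(3) by cases auto
      have "pair_accepts cutting_tapes Final_State (p', q, bottomed z', Simulating t (a = None) e)"
        using step.IH[OF z'_in closed(4) c(5), of e q] step.prems * by simp
      moreover have "pair_step cutting_tapes (p, q, bottomed z, Simulating s d e)
          (p', q, bottomed z', Simulating t (a = None) e)"
        using * c tr closed silent by (auto simp: z z' cutting_def with_tapes_step)
      ultimately show ?thesis by (rule pair_accepts_step[rotated])
    next
      fix a assume *: "x = Some (Inr a)" "s \<in> flat_states T" "u' = u" "v = a # v'"
      from step.prems(4) obtain c q' where c: "\<not> e" "q = Some c # q'" "a = h c" "c \<in> B"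
        "cut_tape (a = None) v' q'"
        unfolding *(4) by cases auto
      have "pair_accepts cutting_tapes Final_State (p, q', bottomed z', Simulating t d (a = None))"
        using step.IH[OF z'_in closed(4) _ c(5), of d p] step.prems * by simp
      moreover have "pair_step cutting_tapes (p, q, bottomed z, Simulating s d e)
          (p, q', bottomed z', Simulating t d (a = None))"
        using * c tr closed silent sides_T[of s]
        by (auto simp: z z' cutting_def with_tapes_step)
      ultimately show ?thesis by (rule pair_accepts_step[rotated])
    qed
  qed
qed

lemma cutting_sound:
  assumes "pair_accepts cutting_tapes Final_State (p, q, y, st)" "y = bottomed z"
  shows "case st of
      Simulating s d e \<Rightarrow> \<exists>u v. cut_tape d u p \<and> cut_tape e v q \<and> pair_accepts T m (u, v, z, s)
    | Sharp_Rest \<Rightarrow> (\<exists>r\<in>lists B. p = end_marked r) \<and> (\<exists>r\<in>lists B. q = end_marked r)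
    | Flat_Rest \<Rightarrow> p = [] \<and> (\<exists>r\<in>lists B. q = end_marked r)
    | Finished \<Rightarrow> p = [] \<and> q = []
    | Failed \<Rightarrow> False
    | Initial \<Rightarrow> True"
  using assms
proof (induction arbitrary: z rule: pair_accepts_induct)
  case (accepting z' s)
  then show ?case by (simp add: cutting_def)
next
  case (step p q y st p' q' y' st')
  obtain x b where y: "y = x @ [b]" using step.hyps(1) by (cases y rule: rev_cases) auto
  note st = step.hyps(1)[unfolded y cutting_def with_tapes_step]
  show ?case
  proof (cases st)
    case (Simulating s d e)
    have s: "s \<in> states T" using st Simulating by simp
    show ?thesis
    proof (cases "d \<and> e \<and> accepting_top T m s b")
      case True
      then have "accepting T m ([], z, s)" using y step.prems by (simp add: accepting_iff_top)
      moreover obtain r r' where "p = end_marked r" "q = end_marked r'" "r \<in> lists B" "r' \<in> lists B"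
        using st True Simulating step.IH[of z] y step.prems by auto
      ultimately show ?thesis
        using True Simulating ended by (auto intro!: exI[of _ "[]"] pair_accepts_accepting)
    next
      case False
      then have "b \<noteq> None" using st step.IH[of z] step.prems y Simulating by auto
      then obtain c z1 where z: "z = z1 @ [c]" "b = Some c" "x = bottomed z1"
        using step.prems y by (cases z rule: rev_cases) auto
      have c: "c \<in> stack_syms T" using st z by auto
      show ?thesis
      proof (cases "trans T None c s")
        case (Some tr)
        then obtain t \<alpha> where t: "trans T None c s = Some (t, \<alpha>)" by (cases tr) auto
        then have "p' = p" "q' = q" "y' = bottomed (z1 @ \<alpha>)" "st' = Simulating t d e"
          using st Simulating False z by auto
        then obtain u v where u: "cut_tape d u p" "cut_tape e v q"
            "pair_accepts T m (u, v, z1 @ \<alpha>, t)"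
          using step.IH[of "z1 @ \<alpha>"] by auto
        have "pair_step T (u, v, z, s) (u, v, z1 @ \<alpha>, t)"
          using z t by (auto simp: pair_step_snoc)
        then have "pair_accepts T m (u, v, z, s)" using u(3) by (rule pair_accepts_step)
        then show ?thesis using u Simulating by auto
      next
        case None
        have reads: "\<exists>t \<alpha>. trans T (Some a) c s = Some (t, \<alpha>)" if "a \<in> tape_alphabet A" for a
          using is_dpda_reads_iff[OF dpda_T c s, of a] that None inputs_T by auto
        show ?thesis
        proof (cases "s \<in> sharp_states T")
          case True
          obtain f where f: "cutting_action T m h st b = Read f"
            using None Simulating False z by auto
          then obtain a where a: "Inl a \<in> tape_alphabet B" "p = a # p'" "q' = q"
              "y' = x @ snd (f (Inl a))" "st' = fst (f (Inl a))"
            using st True Simulating by (auto simp del: cutting_action.simps)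
          have "st' \<noteq> Failed \<or> y' \<noteq> bottomed z" using step.IH[of z] by auto
          then obtain k where k: "a = Some k" "k \<in> B" "\<not> d"
            using a f None Simulating False z y step.prems by (auto split: option.splits if_splits)
          then obtain t \<alpha> where t: "trans T (Some (Inl (h k))) c s = Some (t, \<alpha>)"
            using reads[of "Inl (h k)"] h_in[of k] by auto
          then have "st' = Simulating t (h k = None) e" "y' = bottomed (z1 @ \<alpha>)"
            using a f k None Simulating False z by auto
          then obtain u v where u: "cut_tape (h k = None) u p'" "cut_tape e v q"
              "pair_accepts T m (u, v, z1 @ \<alpha>, t)"
            using step.IH[of "z1 @ \<alpha>"] a by auto
          have "pair_step T (h k # u, v, z, s) (u, v, z1 @ \<alpha>, t)"
            using z t True by (auto simp: pair_step_snoc)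
          then have "pair_accepts T m (h k # u, v, z, s)" using u(3) by (rule pair_accepts_step)
          then show ?thesis using letter[OF k(2) u(1)] u(2) a k Simulating by auto
        next
          case sharp: False
          obtain f where f: "cutting_action T m h st b = Read f"
            using None Simulating False z by auto
          then obtain a where a: "Inr a \<in> tape_alphabet B" "q = a # q'" "p' = p"
              "y' = x @ snd (f (Inr a))" "st' = fst (f (Inr a))"
            using st sharp Simulating by (auto simp del: cutting_action.simps)
          have "st' \<noteq> Failed \<or> y' \<noteq> bottomed z" using step.IH[of z] by auto
          then obtain k where k: "a = Some k" "k \<in> B" "\<not> e"
            using a f None Simulating False z y step.prems by (auto split: option.splits if_splits)
          then obtain t \<alpha> where t: "trans T (Some (Inr (h k))) c s = Some (t, \<alpha>)"
            using reads[of "Inr (h k)"] h_in[of k] by auto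
          then have "st' = Simulating t d (h k = None)" "y' = bottomed (z1 @ \<alpha>)"
            using a f k None Simulating False z by auto
          then obtain u v where u: "cut_tape d u p" "cut_tape (h k = None) v q'"
              "pair_accepts T m (u, v, z1 @ \<alpha>, t)"
            using step.IH[of "z1 @ \<alpha>"] a by auto
          have "pair_step T (u, h k # v, z, s) (u, v, z1 @ \<alpha>, t)"
            using z t sharp s by (auto simp: pair_step_snoc sides_T)
          then have "pair_accepts T m (u, h k # v, z, s)" using u(3) by (rule pair_accepts_step)
          then show ?thesis using letter[OF k(2) u(2)] u(1) a k Simulating by auto
        qed
      qed
    qed
  next
    case Sharp_Rest
    with st obtain a where a: "a \<in> insert None (Some ` B)" "p = a # p'" "q' = q" "y' = y"
        "st' = (if a = None then Flat_Rest else Sharp_Rest)"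
      using y by auto
    then show ?thesis
    proof (cases a)
      case None
      then show ?thesis using a step.IH[OF a(4)[unfolded step.prems]] Sharp_Rest
        by (auto intro!: bexI[of _ "[]"])
    next
      case (Some k)
      then obtain r where "r \<in> lists B" "p' = end_marked r" "\<exists>r\<in>lists B. q = end_marked r"
        using a step.IH[OF a(4)[unfolded step.prems]] by auto
      then show ?thesis using Some a Sharp_Rest by (auto intro!: bexI[of _ "k # r"])
    qed
  next
    case Flat_Rest
    with st obtain a where a: "a \<in> insert None (Some ` B)" "q = a # q'" "p' = p" "y' = y"
        "st' = (if a = None then Finished else Flat_Rest)"
      using y by auto
    then show ?thesis
    proof (cases a)
      case None
      then show ?thesis using a step.IH[OF a(4)[unfolded step.prems]] Flat_Rest
        by (auto intro!: bexI[of _ "[]"])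
    next
      case (Some k)
      then obtain r where "r \<in> lists B" "q' = end_marked r" "p = []"
        using a step.IH[OF a(4)[unfolded step.prems]] by auto
      then show ?thesis using Some a Flat_Rest by (auto intro!: bexI[of _ "k # r"])
    qed
  next
    case Finished
    then show ?thesis using st step.IH[of z] step.prems y by auto
  next
    case Failed
    then show ?thesis using st step.IH[of z] step.prems y by auto
  qed auto
qed

lemma cutting_lang:
  "two_tape_lang B cutting_tapes Final_State =
     {(p, q). p \<in> lists B \<and> q \<in> lists B \<and> (\<exists>(u, v)\<in>two_tape_lang A T m.
        (\<exists>r. map h p = map Some u @ None # r) \<and> (\<exists>r. map h q = map Some v @ None # r))}"
proof -
  have "pair_accepts cutting_tapes Final_State (end_marked p, end_marked q, [None], Initial) \<longleftrightarrow>
    (\<exists>(u, v)\<in>two_tape_lang A T m.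
        (\<exists>r. map h p = map Some u @ None # r) \<and> (\<exists>r. map h q = map Some v @ None # r))"
    (is "?acc \<longleftrightarrow> ?cut") if p: "p \<in> lists B" and q: "q \<in> lists B" for p q
  proof
    assume ?acc
    then have "pair_accepts cutting_tapes Final_State
        (end_marked p, end_marked q, bottomed [start_sym T], Simulating (start_state T) False False)"
      by (cases rule: pair_accepts_cases)
        (auto simp: bottomed_def cutting_def with_tapes_step[where z = "[]", simplified])
    then obtain u v where "cut_tape False u (end_marked p)" "cut_tape False v (end_marked q)"
      and acc: "pair_accepts T m (u, v, [start_sym T], start_state T)"
      using cutting_sound by fastforce
    then obtain u' v' r r' where u: "u = end_marked u'" "map h p = map Some u' @ None # r"
        "v = end_marked v'" "map h q = map Some v' @ None # r'"
      by (fastforce dest!: cut_tapeD)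
    have "set (map h p) \<subseteq> insert None (Some ` A)" "set (map h q) \<subseteq> insert None (Some ` A)"
      using p q h by auto
    then have "u' \<in> lists A" "v' \<in> lists A" using u by auto
    then have "(u', v') \<in> two_tape_lang A T m"
      using acc u by (simp add: two_tape_lang_pair_accepts)
    then show ?cut using u by blast
  next
    assume ?cut
    then obtain u v r r' where u: "map h p = map Some u @ None # r" "map h q = map Some v @ None # r'"
      and acc: "pair_accepts T m (end_marked u, end_marked v, [start_sym T], start_state T)"
      by (auto simp: two_tape_lang_pair_accepts)
    have "pair_accepts cutting_tapes Final_State
        (end_marked p, end_marked q, bottomed [start_sym T], Simulating (start_state T) False False)"
      using cutting_complete[OF acc _ _ cut_tape_end_marked[OF p u(1)] cut_tape_end_marked[OF q u(2)]]
        is_dpdaD[OF dpda_T] by simp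
    moreover have "pair_step cutting_tapes (end_marked p, end_marked q, [None], Initial)
        (end_marked p, end_marked q, bottomed [start_sym T], Simulating (start_state T) False False)"
      by (simp add: bottomed_def cutting_def with_tapes_step[where z = "[]", simplified])
    ultimately show ?acc by (auto intro: pair_accepts_step)
  qed
  moreover have "start_sym cutting = None" "start_state cutting = Initial"
    by (simp_all add: cutting_def)
  ultimately have "pair_accepts cutting_tapes Final_State
      (end_marked p, end_marked q, [start_sym cutting_tapes], start_state cutting_tapes) \<longleftrightarrow>
    (\<exists>(u, v)\<in>two_tape_lang A T m.
        (\<exists>r. map h p = map Some u @ None # r) \<and> (\<exists>r. map h q = map Some v @ None # r))"
    if "p \<in> lists B" "q \<in> lists B" for p q
    using that by simp
  then show ?thesis
    unfolding two_tape_lang_pair_accepts[of B] by blast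
qed

end

lemma is_two_tape_language_prefix:
  assumes "is_two_tape_language A R" "finite B" "h ` B \<subseteq> insert None (Some ` A)"
  shows "is_two_tape_language B
    {(p, q). p \<in> lists B \<and> q \<in> lists B \<and> (\<exists>(u, v)\<in>R. cuts_to h p u \<and> cuts_to h q v)}"
proof -
  obtain T :: "('a, nat, nat) two_tape" and m where T: "is_two_tape A T" "R = two_tape_lang A T m"
    using assms(1) by (auto simp: is_two_tape_language_def)
  have "inputs (cutting T m h B) = tape_alphabet B"
    by (simp add: cutting_def[OF T(1) assms(2,3)])
  then show ?thesis
    using is_two_tape_language_of_countable[OF is_dpda_cutting[OF T(1) assms(2,3), of m], of B
        "cutting_sharp T" Final_State] cutting_lang[OF T(1) assms(2,3), of m] T(2)
    by (simp add: cuts_to_def)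
qed

section \<open>Finite control with an integer counter\<close>

fun counter_run :: "('q \<Rightarrow> 'a \<Rightarrow> 'q) \<Rightarrow> ('q \<Rightarrow> 'a \<Rightarrow> int) \<Rightarrow> 'q \<times> int \<Rightarrow> 'a list \<Rightarrow> 'q \<times> int" where
  "counter_run \<delta> f (q, c) [] = (q, c)"
| "counter_run \<delta> f (q, c) (a # w) = counter_run \<delta> f (\<delta> q a, c + f q a) w"

datatype counter_phase = Adding int | Ready bool

instance counter_phase :: countable
  by countable_datatype

text \<open>
  The counter is kept in unary above a bottom symbol 0.  Its sign is the top symbol, which becomes
  visible only after a pop; therefore the phase \<^term>\<open>Adding 0\<close> inspects the top once more and
  records in the state whether the counter vanishes, as acceptance by final state requires.
\<close>

definition unary :: "int \<Rightarrow> int list" where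
  "unary c = 0 # replicate (nat \<bar>c\<bar>) (sgn c)"

fun counter_action ::
  "('q \<Rightarrow> 'a \<Rightarrow> 'q) \<Rightarrow> ('q \<Rightarrow> 'a \<Rightarrow> int) \<Rightarrow> 'q \<times> counter_phase \<Rightarrow> int \<Rightarrow>
     ('a, int, 'q \<times> counter_phase) action" where
  "counter_action \<delta> f (q, Ready z) b = Read (\<lambda>a. ((\<delta> q a, Adding (f q a)), [b]))"
| "counter_action \<delta> f (q, Adding k) b = Silent
     (if k = 0 then ((q, Ready (b = 0)), [b])
      else if b = - sgn k then ((q, Adding (k - sgn k)), [])
      else ((q, Adding 0), b # replicate (nat \<bar>k\<bar>) (sgn k)))"

lemma unary_snoc: "c \<noteq> 0 \<Longrightarrow> unary c = unary (c - sgn c) @ [sgn c]"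
proof -
  assume c: "c \<noteq> 0"
  define n where "n = nat \<bar>c\<bar> - 1"
  have "nat \<bar>c\<bar> = Suc n" "nat \<bar>c - sgn c\<bar> = n"
    using c by (auto simp: n_def sgn_if)
  moreover have "replicate n (sgn (c - sgn c)) = replicate n (sgn c)"
    using c by (cases "n = 0") (auto simp: n_def sgn_if)
  ultimately show ?thesis
    by (simp add: unary_def replicate_append_same del: replicate_eq_replicate)
qed

lemma unary_top: obtains y where "unary c = y @ [sgn c]"
  by (cases "c = 0") (auto simp: unary_def intro: unary_snoc[unfolded unary_def])

lemma unary_add:
  assumes "k \<noteq> 0" "sgn c \<noteq> - sgn k"
  shows "unary c @ replicate (nat \<bar>k\<bar>) (sgn k) = unary (c + k)"
proof (cases "c = 0")
  case True
  then show ?thesis by (simp add: unary_def)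
next
  case False
  have eq: "sgn c = sgn k" "sgn (c + k) = sgn k" "nat \<bar>c + k\<bar> = nat \<bar>c\<bar> + nat \<bar>k\<bar>"
    using assms False by (auto simp: sgn_if split: if_splits)
  then show ?thesis by (simp add: unary_def replicate_add)
qed

text \<open>
  The automaton is total and all its final states wait for a letter, so its unique run on a word
  decides about acceptance.
\<close>

lemma is_dpda_language_counter:
  fixes \<delta> :: "'q::countable \<Rightarrow> 'a \<Rightarrow> 'q" and f :: "'q \<Rightarrow> 'a \<Rightarrow> int"
  assumes A: "finite A" and Q: "finite Q" and q0: "q0 \<in> Q" and F: "F \<subseteq> Q"
    and \<delta>: "\<And>q a. q \<in> Q \<Longrightarrow> a \<in> A \<Longrightarrow> \<delta> q a \<in> Q"
  shows "is_dpda_language A {w \<in> lists A. counter_run \<delta> f (q0, c0) w \<in> F \<times> {0}}"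
proof -
  define m where "m = Max (insert \<bar>c0\<bar> ((\<lambda>(q, a). \<bar>f q a\<bar>) ` (Q \<times> A)))"
  have fin: "finite (insert \<bar>c0\<bar> ((\<lambda>(q, a). \<bar>f q a\<bar>) ` (Q \<times> A)))" using A Q by simp
  have m: "\<bar>c0\<bar> \<le> m" "\<And>q a. q \<in> Q \<Longrightarrow> a \<in> A \<Longrightarrow> \<bar>f q a\<bar> \<le> m"
    unfolding m_def by (intro Max_ge[OF fin]; force)+
  define S where "S = Q \<times> (Adding ` {-m..m} \<union> range Ready)"
  define M where "M = machine A {-1, 0, 1} S (counter_action \<delta> f) (q0, Adding c0) 0 (F \<times> {Ready True})"
  have S: "(q, Adding k) \<in> S \<longleftrightarrow> q \<in> Q \<and> \<bar>k\<bar> \<le> m" "(q, Ready z) \<in> S \<longleftrightarrow> q \<in> Q" for q k z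
    by (auto simp: S_def image_iff abs_le_iff)
  have within: "action_within A {-1, 0, 1} S (counter_action \<delta> f s b)"
    if "s \<in> S" "b \<in> {-1, 0, 1}" for s b
  proof -
    obtain q ph where s: "s = (q, ph)" by (cases s)
    show ?thesis
    proof (cases ph)
      case (Adding k)
      then have "q \<in> Q" "\<bar>k\<bar> \<le> m" using that s by (auto simp: S)
      moreover have "k \<noteq> 0 \<Longrightarrow> \<bar>k - sgn k\<bar> \<le> m" "sgn k \<in> {-1, 0, 1}" "0 \<le> m"
        using \<open>\<bar>k\<bar> \<le> m\<close> by (auto simp: sgn_if)
      ultimately show ?thesis using that s Adding by (auto simp: S)
    next
      case (Ready z)
      then show ?thesis using that s \<delta> m by (auto simp: S)
    qed
  qed
  have dpda: "is_dpda M"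
    unfolding M_def using A Q q0 F m(1) within by (intro is_dpda_machine) (auto simp: S_def abs_le_iff)
  have add: "(dpda_step M)\<^sup>*\<^sup>* (u, unary c, (q, Adding k)) (u, unary (c + k), (q, Ready (c + k = 0)))"
    if "q \<in> Q" "\<bar>k\<bar> \<le> m" for u c q k
    using that(2)
  proof (induction "nat \<bar>k\<bar>" arbitrary: k c rule: less_induct)
    case less
    obtain y where y: "unary c = y @ [sgn c]" by (rule unary_top)
    have b: "sgn c \<in> {-1, 0, 1}" by (auto simp: sgn_if)
    have check: "(dpda_step M)\<^sup>*\<^sup>* (u, unary c, (q, Adding 0)) (u, unary c, (q, Ready (c = 0)))" for c
    proof -
      obtain y where y: "unary c = y @ [sgn c]" by (rule unary_top)
      show ?thesis
        unfolding M_def y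
        by (intro r_into_rtranclp machine_step_silent) (use that less.prems in \<open>auto simp: S sgn_if\<close>)
    qed
    consider "k = 0" | "k \<noteq> 0" "sgn c = - sgn k" | "k \<noteq> 0" "sgn c \<noteq> - sgn k" by blast
    then show ?case
    proof cases
      case 1
      then show ?thesis using check by simp
    next
      case 2
      have "c \<noteq> 0" using 2 by (metis neg_equal_0_iff_equal sgn_0_0)
      then have "unary c = unary (c - sgn c) @ [sgn c]" by (rule unary_snoc)
      then have "dpda_step M (u, unary c, (q, Adding k)) (u, unary (c - sgn c) @ [], (q, Adding (k - sgn k)))"
        using 2 b that less.prems unfolding M_def by (auto simp: machine_step S)
      moreover have "nat \<bar>k - sgn k\<bar> < nat \<bar>k\<bar>" "\<bar>k - sgn k\<bar> \<le> m"
        using 2 less.prems by (auto simp: sgn_if)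
      moreover have "c - sgn c + (k - sgn k) = c + k" using 2 by simp
      ultimately show ?thesis
        using less.hyps[of "k - sgn k" "c - sgn c"]
        by (metis append_Nil2 converse_rtranclp_into_rtranclp)
    next
      case 3
      have "dpda_step M (u, unary c, (q, Adding k))
          (u, y @ (sgn c # replicate (nat \<bar>k\<bar>) (sgn k)), (q, Adding 0))"
        using 3 b that less.prems unfolding M_def y by (auto simp: machine_step S)
      moreover have "y @ (sgn c # replicate (nat \<bar>k\<bar>) (sgn k)) = unary (c + k)"
        using unary_add[OF 3] y by simp
      ultimately show ?thesis
        using check[of "c + k"] by (simp add: converse_rtranclp_into_rtranclp)
    qed
  qed
  have run: "\<exists>q' c'. counter_run \<delta> f (q, c + k) w = (q', c') \<and>
      (dpda_step M)\<^sup>*\<^sup>* (w, unary c, (q, Adding k)) ([], unary c', (q', Ready (c' = 0)))"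
    if "w \<in> lists A" "q \<in> Q" "\<bar>k\<bar> \<le> m" for w c q k
    using that
  proof (induction w arbitrary: c q k)
    case Nil
    then show ?case using add by simp
  next
    case (Cons a w)
    let ?c = "c + k"
    obtain y where y: "unary ?c = y @ [sgn ?c]" by (rule unary_top)
    have "dpda_step M (a # w, unary ?c, (q, Ready (?c = 0))) (w, unary ?c, (\<delta> q a, Adding (f q a)))"
      using Cons.hyps Cons.prems unfolding y M_def by (auto simp: machine_step S sgn_if)
    moreover obtain q' c' where "counter_run \<delta> f (\<delta> q a, ?c + f q a) w = (q', c')"
      "(dpda_step M)\<^sup>*\<^sup>* (w, unary ?c, (\<delta> q a, Adding (f q a))) ([], unary c', (q', Ready (c' = 0)))"
      using Cons.IH[of "\<delta> q a" "f q a" ?c] Cons.hyps Cons.prems \<delta> m(2) by blast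
    ultimately show ?case
      using add[OF Cons.prems, of "a # w" c]
      by (intro exI[of _ q'] exI[of _ c']) (auto intro: rtranclp_trans converse_rtranclp_into_rtranclp)
  qed
  have halt: "\<not> dpda_step M ([], z, (q, Ready zero)) d" for z q zero d
    by (cases z rule: rev_cases; cases d) (auto simp: M_def machine_step)
  have "accepts M Final_State (w, [0], (q0, Adding c0)) \<longleftrightarrow> counter_run \<delta> f (q0, c0) w \<in> F \<times> {0}"
    if w: "w \<in> lists A" for w
  proof -
    obtain q c where run: "counter_run \<delta> f (q0, c0) w = (q, c)"
      "(dpda_step M)\<^sup>*\<^sup>* (w, [0], (q0, Adding c0)) ([], unary c, (q, Ready (c = 0)))"
      using run[OF w q0 m(1), of 0] by (auto simp: unary_def)
    have "\<not> dpda_step M d e" if "accepting M Final_State d" for d e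
      using that halt by (cases d) (auto simp: M_def)
    then show ?thesis
      using accepts_iff_halting_run[OF dpda run(2) halt] run(1) by (auto simp: M_def)
  qed
  moreover have "inputs M = A" "start_sym M = 0" "start_state M = (q0, Adding c0)"
    by (simp_all add: M_def)
  ultimately have "dpda_lang M Final_State = {w \<in> lists A. counter_run \<delta> f (q0, c0) w \<in> F \<times> {0}}"
    by (simp add: dpda_lang_accepts cong: conj_cong)
  then show ?thesis
    using is_dpda_language_of_countable[OF dpda, of Final_State] by (simp add: M_def)
qed

section \<open>Closure properties of parallel languages\<close>

lemma parallel_poly_pushdown_dpda:
  "is_dpda_language A K \<Longrightarrow> parallel_poly_pushdown A K"
  unfolding parallel_poly_pushdown_def by (intro exI[of _ "{K}"]) auto

lemma at_parallel_poly_pushdown_two_tape: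
  "is_two_tape_language A R \<Longrightarrow> at_parallel_poly_pushdown A R"
  unfolding at_parallel_poly_pushdown_def by (intro exI[of _ "{R}"]) auto

lemma parallel_poly_pushdown_Int:
  assumes "parallel_poly_pushdown A K" "parallel_poly_pushdown A L"
  shows "parallel_poly_pushdown A (K \<inter> L)"
proof -
  obtain E F where "finite E" "E \<noteq> {}" "\<forall>K\<in>E. is_dpda_language A K" "K = \<Inter> E"
    "finite F" "F \<noteq> {}" "\<forall>K\<in>F. is_dpda_language A K" "L = \<Inter> F"
    using assms by (auto simp: parallel_poly_pushdown_def)
  then show ?thesis
    unfolding parallel_poly_pushdown_def by (intro exI[of _ "E \<union> F"]) auto
qed

lemma at_parallel_poly_pushdown_Int:
  assumes "at_parallel_poly_pushdown A K" "at_parallel_poly_pushdown A L"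
  shows "at_parallel_poly_pushdown A (K \<inter> L)"
proof -
  obtain E F where "finite E" "E \<noteq> {}" "\<forall>K\<in>E. is_two_tape_language A K" "K = \<Inter> E"
    "finite F" "F \<noteq> {}" "\<forall>K\<in>F. is_two_tape_language A K" "L = \<Inter> F"
    using assms by (auto simp: at_parallel_poly_pushdown_def)
  then show ?thesis
    unfolding at_parallel_poly_pushdown_def by (intro exI[of _ "E \<union> F"]) auto
qed

lemma at_parallel_poly_pushdown_INT:
  assumes "finite I" "I \<noteq> {}" "\<And>i. i \<in> I \<Longrightarrow> at_parallel_poly_pushdown A (R i)"
  shows "at_parallel_poly_pushdown A (\<Inter>i\<in>I. R i)"
  using assms by (induction rule: finite_ne_induct) (auto intro: at_parallel_poly_pushdown_Int)

lemma cuts_to_unique: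
  assumes "cuts_to h p u" "cuts_to h p v"
  shows "u = v"
proof -
  have "u = v" if "map Some u @ None # r = map Some v @ None # r'" for r r' :: "'b option list"
    using that
  proof (induction u arbitrary: v)
    case Nil
    then show ?case by (cases v) auto
  next
    case (Cons a u)
    then show ?case by (cases v) auto
  qed
  then show ?thesis using assms unfolding cuts_to_def by metis
qed

text \<open>
  Cutting off prefixes commutes with intersections because the prefixes are unique.
\<close>

lemma Inter_unique_preimage:
  assumes unique: "\<And>x y y'. P x y \<Longrightarrow> P x y' \<Longrightarrow> y = y'" and F: "F \<noteq> {}" "L = \<Inter> F"
  shows "{x \<in> S. \<exists>y\<in>L. P x y} = (\<Inter>K\<in>F. {x \<in> S. \<exists>y\<in>K. P x y})"
proof (intro equalityI subsetI)
  fix x assume "x \<in> (\<Inter>K\<in>F. {x \<in> S. \<exists>y\<in>K. P x y})"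
  then have x: "x \<in> S" "\<exists>y\<in>K. P x y" if "K \<in> F" for K using that by simp_all
  obtain K0 where "K0 \<in> F" using F(1) by blast
  then obtain y where y: "x \<in> S" "P x y" using x by blast
  have "y \<in> K" if "K \<in> F" for K using x(2)[OF that] y(2) unique by blast
  then show "x \<in> {x \<in> S. \<exists>y\<in>L. P x y}" using y F(2) by blast
qed (use F(2) in blast)

lemma parallel_poly_pushdown_prefix:
  fixes h :: "'c \<Rightarrow> ('a::countable) option"
  assumes "parallel_poly_pushdown A L" "finite B" "h ` B \<subseteq> insert None (Some ` A)"
  shows "parallel_poly_pushdown B {p \<in> lists B. \<exists>w\<in>L. cuts_to h p w}"
proof -
  obtain F where F: "finite F" "F \<noteq> {}" "\<forall>K\<in>F. is_dpda_language A K" "L = \<Inter> F"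
    using assms(1) by (auto simp: parallel_poly_pushdown_def)
  let ?cut = "\<lambda>K. {p \<in> lists B. \<exists>w\<in>K. cuts_to h p w}"
  have "\<forall>K\<in>?cut ` F. is_dpda_language B K"
    using is_dpda_language_prefix[OF _ assms(2,3)] F(3) by blast
  then show ?thesis
    using F(1,2) Inter_unique_preimage[where P = "cuts_to h" and S = "lists B",
        OF cuts_to_unique F(2,4)]
    unfolding parallel_poly_pushdown_def by (intro exI[of _ "?cut ` F"] conjI) simp_all
qed

lemma at_parallel_poly_pushdown_prefix:
  assumes "at_parallel_poly_pushdown A R" "finite B" "h ` B \<subseteq> insert None (Some ` A)"
  shows "at_parallel_poly_pushdown B
    {(p, q). p \<in> lists B \<and> q \<in> lists B \<and> (\<exists>(u, v)\<in>R. cuts_to h p u \<and> cuts_to h q v)}"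
proof -
  obtain F where F: "finite F" "F \<noteq> {}" "\<forall>K\<in>F. is_two_tape_language A K" "R = \<Inter> F"
    using assms(1) by (auto simp: at_parallel_poly_pushdown_def)
  define P where "P = (\<lambda>(p, q) (u, v). cuts_to h p u \<and> cuts_to h q v)"
  have unique: "y = y'" if "P x y" "P x y'" for x y y'
    using that cuts_to_unique[of h] by (cases x; cases y; cases y') (simp add: P_def, blast)
  have set_eq: "{(p, q). p \<in> lists B \<and> q \<in> lists B \<and> (\<exists>(u, v)\<in>R. cuts_to h p u \<and> cuts_to h q v)} =
      {x \<in> lists B \<times> lists B. \<exists>y\<in>R. P x y}" for R
    by (auto simp: P_def)
  let ?cut = "\<lambda>R. {x \<in> lists B \<times> lists B. \<exists>y\<in>R. P x y}"
  have "\<forall>K\<in>?cut ` F. is_two_tape_language B K"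
    using is_two_tape_language_prefix[OF _ assms(2,3)] F(3) by (simp add: set_eq)
  then show ?thesis
    using F(1,2) Inter_unique_preimage[where P = P and S = "lists B \<times> lists B", OF unique F(2,4)]
    unfolding set_eq at_parallel_poly_pushdown_def by (intro exI[of _ "?cut ` F"] conjI) simp_all
qed

text \<open>
  For a letter of trivial value, the multiplication relation of a structure is the equality of two
  words of the language.  It is the intersection of the diagonal with conditions on the first tape alone,
  and a one-tape automaton that finds the end of the first word by itself decides the latter.
\<close>

lemma at_parallel_poly_pushdown_diagonal:
  fixes A :: "('a::countable) set"
  assumes L: "parallel_poly_pushdown A L" "L \<subseteq> lists A" and A: "finite A"
  shows "at_parallel_poly_pushdown A {(u, v). u \<in> L \<and> u = v}"
proof -
  obtain F where F: "finite F" "F \<noteq> {}" "\<forall>K\<in>F. is_dpda_language A K" "L = \<Inter> F"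
    using L(1) by (auto simp: parallel_poly_pushdown_def)
  let ?B = "insert None (Some ` A)"
  let ?E = "\<lambda>K. {(u, v). u \<in> lists A \<and> v \<in> lists A \<and> u \<in> K}"
  have "is_two_tape_language A (?E K)" if "K \<in> F" for K
  proof -
    let ?D = "{p \<in> lists ?B. \<exists>w\<in>K. cuts_to (\<lambda>x. x) p w}"
    have "is_dpda_language ?B ?D"
      by (rule is_dpda_language_prefix) (use F(3) that A in auto)
    then have E: "is_two_tape_language A
        {(u, v). u \<in> lists A \<and> v \<in> lists A \<and> end_marked u @ end_marked v \<in> ?D}"
      by (rule is_two_tape_language_sequential[OF _ A])
    have D: "end_marked u @ end_marked v \<in> ?D \<longleftrightarrow> u \<in> K"
      if "u \<in> lists A" "v \<in> lists A" for u v
    proof -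
      have "end_marked u @ end_marked v \<in> lists ?B"
        using that by (auto simp: end_marked_def)
      moreover have "cuts_to (\<lambda>x. x) (end_marked u @ end_marked v) u"
        by (simp add: cuts_to_def end_marked_def)
      ultimately show ?thesis using cuts_to_unique by blast
    qed
    have "{(u, v). u \<in> lists A \<and> v \<in> lists A \<and> end_marked u @ end_marked v \<in> ?D} = ?E K"
      using D by blast
    with E show ?thesis by (simp only:)
  qed
  then have "at_parallel_poly_pushdown A (\<Inter>K\<in>F. ?E K)"
    using F by (intro at_parallel_poly_pushdown_INT at_parallel_poly_pushdown_two_tape) auto
  then have "at_parallel_poly_pushdown A ((\<Inter>K\<in>F. ?E K) \<inter> {(u, v). u \<in> lists A \<and> u = v})"
    by (rule at_parallel_poly_pushdown_Int)
      (intro at_parallel_poly_pushdown_two_tape is_two_tape_language_diagonal[OF A])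
  moreover have *: "(u, v) \<in> (\<Inter>K\<in>F. ?E K) \<inter> {(u, v). u \<in> lists A \<and> u = v} \<longleftrightarrow> u \<in> L \<and> u = v" for u v
  proof
    assume "u \<in> L \<and> u = v"
    moreover from this have "u \<in> lists A" using L(2) by blast
    ultimately show "(u, v) \<in> (\<Inter>K\<in>F. ?E K) \<inter> {(u, v). u \<in> lists A \<and> u = v}"
      unfolding F(4) by auto
  qed (auto simp: F(2,4))
  then have "(\<Inter>K\<in>F. ?E K) \<inter> {(u, v). u \<in> lists A \<and> u = v} = {(u, v). u \<in> L \<and> u = v}"
    unfolding set_eq_iff split_paired_All mem_Collect_eq case_prod_conv by (intro allI)
  ultimately show ?thesis by (simp only:)
qed

section \<open>Regular and linear conditions\<close>

lemma counter_run_zero: "counter_run \<delta> (\<lambda>_ _. 0) (q, c) w = (foldl \<delta> q w, c)"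
  by (induction w arbitrary: q) auto

lemma is_dpda_language_regular:
  fixes \<delta> :: "'q::countable \<Rightarrow> 'a \<Rightarrow> 'q"
  assumes "finite A" "finite Q" "q0 \<in> Q" "F \<subseteq> Q" "\<And>q a. q \<in> Q \<Longrightarrow> a \<in> A \<Longrightarrow> \<delta> q a \<in> Q"
  shows "is_dpda_language A {w \<in> lists A. foldl \<delta> q0 w \<in> F}"
  using is_dpda_language_counter[of A Q q0 F \<delta> "\<lambda>_ _. 0" 0] assms by (simp add: counter_run_zero)

lemma is_two_tape_language_regular:
  fixes \<delta> :: "'q::countable \<Rightarrow> 'a \<Rightarrow> 'q"
  assumes A: "finite A" and Q: "finite Q" "q0 \<in> Q" "F \<subseteq> Q"
    and \<delta>: "\<And>q a. q \<in> Q \<Longrightarrow> a \<in> A \<Longrightarrow> \<delta> q a \<in> Q"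
  shows "is_two_tape_language A
    {(u, v). u \<in> lists A \<and> v \<in> lists A \<and> foldl \<delta> q0 u \<in> F \<and> foldl \<delta> q0 v \<in> F}"
proof -
  (* the state None records that the first word has been rejected *)
  define \<gamma> where "\<gamma> p x = Option.bind p (\<lambda>q. case x of
      Some a \<Rightarrow> Some (\<delta> q a) | None \<Rightarrow> if q \<in> F then Some q0 else None)" for p x
  have step: "foldl \<gamma> (Some q) (end_marked u) = (if foldl \<delta> q u \<in> F then Some q0 else None)" for q u
    by (induction u arbitrary: q) (simp_all add: \<gamma>_def)
  have dead: "foldl \<gamma> None w = None" for w
    by (induction w) (simp_all add: \<gamma>_def)
  have "is_dpda_language (insert None (Some ` A))
      {w \<in> lists (insert None (Some ` A)). foldl \<gamma> (Some q0) w \<in> {Some q0}}" (is "is_dpda_language _ ?D")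
    using A Q \<delta> by (intro is_dpda_language_regular[where Q = "insert None (Some ` Q)"])
      (auto simp: \<gamma>_def split: option.splits)
  then have "is_two_tape_language A
      {(u, v). u \<in> lists A \<and> v \<in> lists A \<and> end_marked u @ end_marked v \<in> ?D}"
    by (rule is_two_tape_language_sequential[OF _ A])
  moreover have D: "end_marked u @ end_marked v \<in> ?D \<longleftrightarrow> foldl \<delta> q0 u \<in> F \<and> foldl \<delta> q0 v \<in> F"
    if "u \<in> lists A" "v \<in> lists A" for u v
  proof -
    have "end_marked u @ end_marked v \<in> lists (insert None (Some ` A))"
      using that by (auto simp: end_marked_def)
    then show ?thesis by (simp add: step dead)
  qed
  ultimately show ?thesis by (simp cong: conj_cong del: in_lists_conv_set mem_Collect_eq)
qed

text \<open>
  One counter suffices: the weights on the first tape are added and those on the second one are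
  subtracted.
\<close>

lemma is_two_tape_language_linear:
  fixes f g :: "'a \<Rightarrow> int"
  assumes A: "finite A"
  shows "is_two_tape_language A
    {(u, v). u \<in> lists A \<and> v \<in> lists A \<and> c + sum_list (map f u) = sum_list (map g v)}"
proof -
  (* the state tells whether the first end letter has been read *)
  define \<delta> where "\<delta> second x \<longleftrightarrow> second \<or> x = None" for second and x :: "'a option"
  define wt where "wt second x = (case x of None \<Rightarrow> 0 | Some a \<Rightarrow> if second then - g a else f a)"
    for second x
  have second: "counter_run \<delta> wt (True, c) (end_marked v) = (True, c - sum_list (map g v))" for c v
    by (induction v arbitrary: c) (simp_all add: \<delta>_def wt_def)
  have first: "counter_run \<delta> wt (False, c) (end_marked u @ end_marked v) =
      (True, c + sum_list (map f u) - sum_list (map g v))" for c u v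
    by (induction u arbitrary: c) (simp_all add: \<delta>_def wt_def second)
  have "is_dpda_language (insert None (Some ` A))
      {w \<in> lists (insert None (Some ` A)). counter_run \<delta> wt (False, c) w \<in> {True} \<times> {0}}"
      (is "is_dpda_language _ ?D")
    using A by (intro is_dpda_language_counter[where Q = UNIV]) auto
  then have "is_two_tape_language A
      {(u, v). u \<in> lists A \<and> v \<in> lists A \<and> end_marked u @ end_marked v \<in> ?D}"
    by (rule is_two_tape_language_sequential[OF _ A])
  moreover have D: "end_marked u @ end_marked v \<in> ?D \<longleftrightarrow> c + sum_list (map f u) = sum_list (map g v)"
    if "u \<in> lists A" "v \<in> lists A" for u v
  proof -
    have "end_marked u @ end_marked v \<in> lists (insert None (Some ` A))"
      using that by (auto simp: end_marked_def)
    then show ?thesis by (simp add: first)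
  qed
  ultimately show ?thesis by (simp cong: conj_cong del: in_lists_conv_set mem_Collect_eq)
qed

section \<open>Normal words for integer vectors\<close>

text \<open>
  The pair \<^term>\<open>(i, s)\<close> stands for the \<open>i\<close>-th unit vector or, if \<open>s\<close> is false, for its negative.
\<close>

definition signed :: "nat \<Rightarrow> (nat \<times> bool) list \<Rightarrow> int" where
  "signed i u = sum_list (map (\<lambda>(j, s). if j = i then if s then 1 else -1 else 0) u)"

fun compatible :: "nat \<times> bool \<Rightarrow> nat \<times> bool \<Rightarrow> bool" where
  "compatible (i, s) (j, t) \<longleftrightarrow> i < j \<or> i = j \<and> s = t"

abbreviation normal_form :: "(nat \<times> bool) list \<Rightarrow> bool" where
  "normal_form \<equiv> sorted_wrt compatible"

lemma signed_Nil [simp]: "signed i [] = 0"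
  and signed_Cons [simp]: "signed i ((j, s) # u) = (if j = i then if s then 1 else -1 else 0) + signed i u"
  and signed_append [simp]: "signed i (u @ v) = signed i u + signed i v"
  by (simp_all add: signed_def)

lemma signed_replicate [simp]:
  "signed i (replicate k (j, s)) = (if j = i then if s then int k else - int k else 0)"
  by (induction k) auto

lemma transp_compatible: "compatible p q \<Longrightarrow> compatible q r \<Longrightarrow> compatible p r"
  by (cases p; cases q; cases r) auto

lemma signed_normal_less:
  "normal_form ((j, s) # u) \<Longrightarrow> i < j \<Longrightarrow> signed i ((j, s) # u) = 0"
  by (induction u) auto

lemma signed_normal_head:
  "normal_form ((j, s) # u) \<Longrightarrow> if s then 0 < signed j ((j, s) # u) else signed j ((j, s) # u) < 0"
  by (induction u) (auto split: if_splits)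

text \<open>
  The indices of a normal word increase weakly and all its letters of the same index have the same sign.
  Hence the first letter can be read off the signed numbers of letters: its index is the least one
  with a nonzero number, whose sign is the sign of the letter.
\<close>

lemma normal_eqI:
  assumes "normal_form u" "normal_form v" "\<And>i. signed i u = signed i v"
  shows "u = v"
  using assms
proof (induction u arbitrary: v)
  case Nil
  show ?case
  proof (cases v)
    case (Cons p v')
    obtain j t where p: "p = (j, t)" by (cases p)
    have "if t then 0 < signed j v else signed j v < 0"
      using signed_normal_head[of j t v'] Nil.prems(2) Cons p by blast
    then show ?thesis using Nil.prems(3)[of j] by (simp split: if_splits)
  qed simp
next
  case (Cons p u)
  obtain i s where p: "p = (i, s)" by (cases p)
  have head: "if s then 0 < signed i (p # u) else signed i (p # u) < 0"
    using signed_normal_head Cons.prems(1) p by blast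
  show ?case
  proof (cases v)
    case Nil
    then show ?thesis using head Cons.prems(3)[of i] by (auto split: if_splits)
  next
    case (Cons q v')
    obtain j t where q: "q = (j, t)" by (cases q)
    have head': "if t then 0 < signed j (q # v') else signed j (q # v') < 0"
      using signed_normal_head Cons.prems(2) q \<open>v = q # v'\<close> by blast
    have "signed j (p # u) = signed j (q # v')" "signed i (p # u) = signed i (q # v')"
      using Cons.prems(3) \<open>v = q # v'\<close> by blast+
    moreover have "j < i \<Longrightarrow> signed j (p # u) = 0" "i < j \<Longrightarrow> signed i (q # v') = 0"
      using signed_normal_less Cons.prems(1,2) p q \<open>v = q # v'\<close> by blast+
    ultimately have "\<not> j < i" "\<not> i < j"
      using head head' by (auto simp del: signed_Cons split: if_splits)
    then have "i = j" by simp
    moreover from this have "s = t"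
      using head head' Cons.prems(3)[of i] \<open>v = q # v'\<close> by (auto split: if_splits)
    ultimately have "p = q" using p q by simp
    moreover have "u = v'"
    proof (rule Cons.IH)
      show "signed k u = signed k v'" for k
        using Cons.prems(3)[of k] \<open>v = q # v'\<close> \<open>p = q\<close> q by simp
    qed (use Cons.prems \<open>v = q # v'\<close> in auto)
    ultimately show ?thesis using \<open>v = q # v'\<close> by simp
  qed
qed

fun normal_word :: "(nat \<Rightarrow> int) \<Rightarrow> nat \<Rightarrow> (nat \<times> bool) list" where
  "normal_word y 0 = []"
| "normal_word y (Suc k) = normal_word y k @ replicate (nat \<bar>y k\<bar>) (k, 0 \<le> y k)"

lemma normal_word_lists: "normal_word y k \<in> lists ({..<k} \<times> UNIV)"
  by (induction k) (fastforce simp: in_lists_conv_set split: if_splits)+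

lemma normal_normal_word: "normal_form (normal_word y k)"
proof (induction k)
  case (Suc k)
  have "normal_form (replicate m (k, s))" for m s
    by (induction m) (auto simp: sorted_wrt.simps)
  moreover have "compatible p q" if "p \<in> set (normal_word y k)" "q \<in> set (replicate m (k, s))" for p q m s
    using that normal_word_lists[of y k] by (cases p; cases q) (auto simp: in_lists_conv_set)
  ultimately show ?case using Suc unfolding normal_word.simps sorted_wrt_append by blast
qed simp

lemma signed_normal_word: "signed i (normal_word y k) = (if i < k then y i else 0)"
  by (induction k) (auto simp: less_Suc_eq)

section \<open>Words for elements of the semidirect product\<close>

datatype letter = Old nat | Mark | Gen nat bool

instance letter :: countable
  by countable_datatype

text \<open>
  The letter \<^term>\<open>Mark\<close> has trivial value and ends the word for the element of the quotient, so that
  this word can be cut off even if the word for the vector is empty.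
\<close>

definition letters :: "nat set \<Rightarrow> nat \<Rightarrow> nat set" where
  "letters A n = to_nat ` (Old ` A \<union> {Mark} \<union> (\<lambda>(i, s). Gen i s) ` ({..<n} \<times> UNIV))"

fun gens :: "(nat \<times> bool) list \<Rightarrow> nat list" where
  "gens [] = []"
| "gens ((i, s) # u) = to_nat (Gen i s) # gens u"

definition word :: "nat list \<Rightarrow> (nat \<times> bool) list \<Rightarrow> nat list" where
  "word w u = map (to_nat \<circ> Old) w @ to_nat Mark # gens u"

definition old_letter :: "nat \<Rightarrow> nat option" where
  "old_letter x = (case from_nat x of Old a \<Rightarrow> Some a | _ \<Rightarrow> None)"

lemma finite_letters: "finite A \<Longrightarrow> finite (letters A n)"
  by (simp add: letters_def)

lemma letters_cases:
  assumes "x \<in> letters A n"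
  obtains a where "a \<in> A" "x = to_nat (Old a)"
    | "x = to_nat Mark"
    | i s where "i < n" "x = to_nat (Gen i s)"
  using assms by (auto simp: letters_def)

lemma to_nat_letters [simp]:
  "to_nat (Old a) \<in> letters A n \<longleftrightarrow> a \<in> A"
  "to_nat Mark \<in> letters A n"
  "to_nat (Gen i s) \<in> letters A n \<longleftrightarrow> i < n"
  by (auto simp: letters_def image_iff)

lemma gens_in_letters: "gens u \<in> lists (letters A n) \<longleftrightarrow> u \<in> lists ({..<n} \<times> UNIV)"
  by (induction u rule: gens.induct) auto

lemma Gen_Cons_eq_gens: "to_nat (Gen i s) # p = gens u \<longleftrightarrow> (\<exists>v. u = (i, s) # v \<and> p = gens v)"
  by (cases u rule: gens.cases) auto

lemma word_in_letters [simp]: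
  "word w u \<in> lists (letters A n) \<longleftrightarrow> w \<in> lists A \<and> u \<in> lists ({..<n} \<times> UNIV)"
  using gens_in_letters[of u A n] by (auto simp: word_def)

lemma old_letter_simps [simp]:
  "old_letter (to_nat (Old a)) = Some a" "old_letter (to_nat Mark) = None"
  "old_letter (to_nat (Gen i s)) = None"
  by (simp_all add: old_letter_def)

lemma old_letter_letters: "old_letter ` letters A n \<subseteq> insert None (Some ` A)"
  by (auto simp: letters_def)

lemma cuts_to_word: "cuts_to old_letter (word w u) w'  \<longleftrightarrow> w' = w"
proof
  have "cuts_to old_letter (word w u) w"
    by (simp add: cuts_to_def word_def)
  then show "w' = w" if "cuts_to old_letter (word w u) w'" using cuts_to_unique that by blast
  then show "cuts_to old_letter (word w u) w'" if "w' = w"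
    using \<open>cuts_to old_letter (word w u) w\<close> that by simp
qed

datatype shape = Head | Tail "(nat \<times> bool) option" | Bad

instance shape :: countable
  by countable_datatype

fun next_shape :: "shape \<Rightarrow> letter \<Rightarrow> shape" where
  "next_shape Head (Old a) = Head"
| "next_shape Head Mark = Tail None"
| "next_shape (Tail None) (Gen i s) = Tail (Some (i, s))"
| "next_shape (Tail (Some p)) (Gen i s) = (if compatible p (i, s) then Tail (Some (i, s)) else Bad)"
| "next_shape _ _ = Bad"

abbreviation shape_of :: "shape \<Rightarrow> nat list \<Rightarrow> shape" where
  "shape_of \<equiv> foldl (\<lambda>q x. next_shape q (from_nat x))"

definition normal_words :: "nat set \<Rightarrow> nat \<Rightarrow> nat list set" where
  "normal_words A n = {word w u |w u. w \<in> lists A \<and> u \<in> lists ({..<n} \<times> UNIV) \<and> normal_form u}"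

lemma shape_of_Bad [simp]: "shape_of Bad p = Bad"
  by (induction p) auto

text \<open>
  Compatibility is transitive, so that it is enough to compare each letter with its predecessor.
\<close>

lemma shape_of_Tail:
  assumes "p \<in> lists (letters A n)"
  shows "shape_of (Tail l) p \<in> range Tail \<longleftrightarrow>
    (\<exists>u\<in>lists ({..<n} \<times> UNIV). p = gens u \<and>
       normal_form (case l of None \<Rightarrow> u | Some q \<Rightarrow> q # u))"
  using assms
proof (induction p arbitrary: l)
  case Nil
  have "normal_form (case l of None \<Rightarrow> [] | Some q \<Rightarrow> q # [])"
    by (cases l) simp_all
  then show ?case by (simp only: foldl_Nil rangeI simp_thms) (intro bexI[of _ "[]"], simp_all)
next
  case (Cons x p)
  from Cons.hyps(1) show ?case
  proof (cases rule: letters_cases)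
    case (3 i s)
    have cons: "(\<exists>u\<in>lists ({..<n} \<times> UNIV). x # p = gens u \<and> P u) \<longleftrightarrow>
      (\<exists>u\<in>lists ({..<n} \<times> UNIV). p = gens u \<and> P ((i, s) # u))" for P
    proof -
      have "(i, s) # u \<in> lists ({..<n} \<times> UNIV) \<longleftrightarrow> u \<in> lists ({..<n} \<times> UNIV)" for u :: "(nat \<times> bool) list"
        using 3 by simp
      then show ?thesis unfolding 3(2) Gen_Cons_eq_gens Bex_def by blast
    qed
    show ?thesis
    proof (cases l)
      case None
      have step: "shape_of (Tail l) (x # p) = shape_of (Tail (Some (i, s))) p"
        using None 3 by simp
      show ?thesis
        unfolding step unfolding None option.case cons[of normal_form]
        using Cons.IH[of "Some (i, s)"] by (simp only: option.case)
    next
      case (Some q)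
      have *: "normal_form (q # (i, s) # u) \<longleftrightarrow> compatible q (i, s) \<and> normal_form ((i, s) # u)" for u
        using transp_compatible[of q "(i, s)"] unfolding sorted_wrt.simps list.set by blast
      have step: "shape_of (Tail l) (x # p) =
          (if compatible q (i, s) then shape_of (Tail (Some (i, s))) p else Bad)"
        using Some 3 by simp
      show ?thesis
      proof (cases "compatible q (i, s)")
        case True
        then show ?thesis
          unfolding step unfolding Some option.case cons[of "\<lambda>u. normal_form (q # u)"] *
          using Cons.IH[of "Some (i, s)"] by (simp only: if_True simp_thms option.case)
      next
        case False
        then show ?thesis
          unfolding step unfolding Some option.case cons[of "\<lambda>u. normal_form (q # u)"] * by auto
      qed
    qed
  next
    case (1 a)
    then have "x # p \<noteq> gens u" for u
      by (cases u rule: gens.cases) auto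
    moreover have "next_shape (Tail l) (from_nat x) = Bad"
      using 1 by (cases l) simp_all
    ultimately show ?thesis by auto
  next
    case 2
    then have "x # p \<noteq> gens u" for u
      by (cases u rule: gens.cases) auto
    moreover have "next_shape (Tail l) (from_nat x) = Bad"
      using 2 by (cases l) simp_all
    ultimately show ?thesis by auto
  qed
qed

lemma shape_of_Head:
  assumes "p \<in> lists (letters A n)"
  shows "shape_of Head p \<in> range Tail \<longleftrightarrow> p \<in> normal_words A n"
  using assms
proof (induction p)
  case Nil
  then show ?case by (auto simp: normal_words_def word_def)
next
  case (Cons x p)
  from Cons.hyps(1) show ?case
  proof (cases rule: letters_cases)
    case (1 a)
    have "x # p \<in> normal_words A n \<longleftrightarrow> p \<in> normal_words A n"
    proof
      assume "x # p \<in> normal_words A n"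
      then obtain w u where w: "x # p = word w u" "w \<in> lists A" "u \<in> lists ({..<n} \<times> UNIV)"
        "normal_form u" by (auto simp: normal_words_def)
      then obtain w' where "w = a # w'" "p = word w' u"
        using 1 by (cases w) (auto simp: word_def)
      then show "p \<in> normal_words A n" using w by (auto simp: normal_words_def)
    next
      assume "p \<in> normal_words A n"
      then obtain w u where "p = word w u" "w \<in> lists A" "u \<in> lists ({..<n} \<times> UNIV)"
        "normal_form u" by (auto simp: normal_words_def)
      moreover from this have "x # p = word (a # w) u" using 1 by (simp add: word_def)
      ultimately show "x # p \<in> normal_words A n" using 1 by (force simp: normal_words_def)
    qed
    then show ?thesis using Cons.IH 1 by simp
  next
    case 2
    have "x # p \<in> normal_words A n \<longleftrightarrow>
      (\<exists>u\<in>lists ({..<n} \<times> UNIV). p = gens u \<and> normal_form u)"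
    proof
      assume "x # p \<in> normal_words A n"
      then obtain w u where w: "x # p = word w u" "w \<in> lists A" "u \<in> lists ({..<n} \<times> UNIV)"
        "normal_form u" by (auto simp: normal_words_def)
      then have "p = gens u"
        using 2 by (cases w) (auto simp: word_def)
      then show "\<exists>u\<in>lists ({..<n} \<times> UNIV). p = gens u \<and> normal_form u"
        using w by blast
    next
      assume "\<exists>u\<in>lists ({..<n} \<times> UNIV). p = gens u \<and> normal_form u"
      then obtain u where "x # p = word [] u" "u \<in> lists ({..<n} \<times> UNIV)" "normal_form u"
        using 2 by (auto simp: word_def)
      then show "x # p \<in> normal_words A n" unfolding normal_words_def by blast
    qed
    then show ?thesis using shape_of_Tail[OF Cons.hyps(2), of None] 2 by simp
  next
    case (3 i s)
    have "x # p \<noteq> word w u" for w u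
      using 3 by (cases w) (auto simp: word_def)
    then show ?thesis using 3 by (auto simp: normal_words_def)
  qed
qed

definition shapes :: "nat \<Rightarrow> shape set" where
  "shapes n = {Head, Bad} \<union> Tail ` insert None (Some ` ({..<n} \<times> UNIV))"

lemma next_shape_shapes:
  assumes "q \<in> shapes n" "x \<in> letters A n"
  shows "next_shape q (from_nat x) \<in> shapes n"
  using assms(2)
proof (cases rule: letters_cases)
  case (3 i s)
  show ?thesis
  proof (cases q)
    case (Tail l)
    then show ?thesis using 3 by (cases l) (auto simp: shapes_def)
  qed (use 3 in \<open>auto simp: shapes_def\<close>)
qed (use assms(1) in \<open>auto simp: shapes_def\<close>)

lemma normal_words_letters: "normal_words A n \<subseteq> lists (letters A n)"
proof
  fix p assume "p \<in> normal_words A n"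
  then obtain w u where "p = word w u" "w \<in> lists A" "u \<in> lists ({..<n} \<times> UNIV)"
    unfolding normal_words_def by blast
  then show "p \<in> lists (letters A n)" by (simp only: word_in_letters simp_thms)
qed

lemma shape_of_accepted:
  "p \<in> lists (letters A n) \<and> shape_of Head p \<in> shapes n \<inter> range Tail \<longleftrightarrow> p \<in> normal_words A n"
proof (cases "p \<in> lists (letters A n)")
  case True
  then have "shape_of q p \<in> shapes n" if "q \<in> shapes n" for q
    using that by (induction p arbitrary: q) (simp_all add: next_shape_shapes)
  then have "shape_of Head p \<in> shapes n" by (simp add: shapes_def)
  then show ?thesis using True shape_of_Head[OF True] by (simp only: Int_iff simp_thms)
next
  case False
  then have "p \<notin> normal_words A n" by (rule contra_subsetD[OF normal_words_letters])
  then show ?thesis using False by (simp only: simp_thms)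
qed

lemma shapes_facts: "finite (shapes n)" "Head \<in> shapes n" "shapes n \<inter> range Tail \<subseteq> shapes n"
  by (simp add: shapes_def, simp add: shapes_def, rule Int_lower1)

lemma is_dpda_language_normal_words:
  assumes "finite A"
  shows "is_dpda_language (letters A n) (normal_words A n)"
proof -
  have "is_dpda_language (letters A n)
      {p \<in> lists (letters A n). shape_of Head p \<in> shapes n \<inter> range Tail}"
    by (rule is_dpda_language_regular[where Q = "shapes n"])
      (simp_all only: finite_letters[OF assms] next_shape_shapes shapes_facts)
  then show ?thesis by (simp only: shape_of_accepted Collect_mem_eq)
qed

lemma is_two_tape_language_normal_words:
  assumes "finite A"
  shows "is_two_tape_language (letters A n) (normal_words A n \<times> normal_words A n)"
proof -
  have "is_two_tape_language (letters A n)
      {(p, q). p \<in> lists (letters A n) \<and> q \<in> lists (letters A n) \<and>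
        shape_of Head p \<in> shapes n \<inter> range Tail \<and> shape_of Head q \<in> shapes n \<inter> range Tail}"
    by (rule is_two_tape_language_regular[where Q = "shapes n"])
      (simp_all only: finite_letters[OF assms] next_shape_shapes shapes_facts)
  moreover have "p \<in> lists (letters A n) \<and> q \<in> lists (letters A n) \<and>
        shape_of Head p \<in> shapes n \<inter> range Tail \<and> shape_of Head q \<in> shapes n \<inter> range Tail \<longleftrightarrow>
      p \<in> normal_words A n \<and> q \<in> normal_words A n" for p q
    by (simp only: shape_of_accepted[symmetric] conj_ac)
  moreover have "{(p, q). p \<in> W \<and> q \<in> W} = W \<times> W" for W :: "nat list set" by auto
  ultimately show ?thesis by (simp only:)
qed

section \<open>The structure on the semidirect product\<close>

lemma word_value_simps [simp]:
  "word_value G \<pi> [] = \<one>\<^bsub>G\<^esub>"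
  "word_value G \<pi> (a # w) = \<pi> a \<otimes>\<^bsub>G\<^esub> word_value G \<pi> w"
  by (simp_all add: word_value_def)

lemma (in monoid) word_value_closed:
  "\<pi> \<in> A \<rightarrow> carrier G \<Longrightarrow> w \<in> lists A \<Longrightarrow> word_value G \<pi> w \<in> carrier G"
  by (induction w) auto

lemma (in monoid) word_value_append:
  "\<pi> \<in> A \<rightarrow> carrier G \<Longrightarrow> u \<in> lists A \<Longrightarrow> v \<in> lists A \<Longrightarrow>
     word_value G \<pi> (u @ v) = word_value G \<pi> u \<otimes> word_value G \<pi> v"
proof (induction u)
  case (Cons a u)
  then show ?case
    using word_value_closed[of \<pi> A] by (auto simp: m_assoc Pi_iff simp del: in_lists_conv_set)
qed (simp add: word_value_closed[of \<pi> A])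

definition unit_vector :: "nat \<Rightarrow> nat \<Rightarrow> bool \<Rightarrow> nat \<Rightarrow> int" where
  "unit_vector n i s = (\<lambda>j\<in>{..<n}. if i = j then if s then 1 else -1 else 0)"

definition vector :: "nat \<Rightarrow> (nat \<times> bool) list \<Rightarrow> nat \<Rightarrow> int" where
  "vector n u = (\<lambda>j\<in>{..<n}. signed j u)"

lemma unit_vector_closed [simp]: "unit_vector n i s \<in> carrier (int_power_group n)"
  and vector_closed [simp]: "vector n u \<in> carrier (int_power_group n)"
  by (auto simp: unit_vector_def vector_def)

lemma vector_apply: "j < n \<Longrightarrow> vector n u j = signed j u"
  by (simp add: vector_def)

lemma vector_Nil: "vector n [] = \<one>\<^bsub>int_power_group n\<^esub>"
  by (simp add: vector_def)

lemma vector_Cons: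
  "vector n ((i, s) # u) = unit_vector n i s \<otimes>\<^bsub>int_power_group n\<^esub> vector n u"
  by (rule ext) (simp add: vector_def unit_vector_def)

lemma vector_eqD:
  assumes "vector n u = vector n v" "u \<in> lists ({..<n} \<times> UNIV)" "v \<in> lists ({..<n} \<times> UNIV)"
    "normal_form u" "normal_form v"
  shows "u = v"
proof (rule normal_eqI[OF assms(4,5)])
  fix i
  have "signed i w = 0" if "w \<in> lists ({..<n} \<times> UNIV)" "\<not> i < n" for w
    using that by (induction w) auto
  then show "signed i u = signed i v"
    using fun_cong[OF assms(1), of i] assms(2,3) by (cases "i < n") (simp_all add: vector_def)
qed

lemma vector_surj:
  assumes "y \<in> carrier (int_power_group n)"
  obtains u where "u \<in> lists ({..<n} \<times> UNIV)" "normal_form u" "vector n u = y"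
proof
  show "vector n (normal_word y n) = y"
    using assms by (auto simp: vector_def signed_normal_word PiE_iff extensional_def fun_eq_iff)
qed (rule normal_word_lists normal_normal_word)+

lemma group_int_power_group: "group (int_power_group n)"
  by simp

lemma int_power_group_mult_apply:
  "j < n \<Longrightarrow> (x \<otimes>\<^bsub>int_power_group n\<^esub> y) j = x j + y j"
  by simp

lemma int_power_group_eqI:
  assumes "x \<in> carrier (int_power_group n)" "y \<in> carrier (int_power_group n)"
    "\<And>j. j < n \<Longrightarrow> x j = y j"
  shows "x = y"
  using assms by (intro PiE_ext[of x "{..<n}"]) auto

lemma semidirect_product_simps [simp]:
  "carrier (semidirect_product N H \<phi>) = carrier N \<times> carrier H"
  "(x, h) \<otimes>\<^bsub>semidirect_product N H \<phi>\<^esub> (y, k) = (x \<otimes>\<^bsub>N\<^esub> \<phi> h y, h \<otimes>\<^bsub>H\<^esub> k)"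
  "\<one>\<^bsub>semidirect_product N H \<phi>\<^esub> = (\<one>\<^bsub>N\<^esub>, \<one>\<^bsub>H\<^esub>)"
  by (simp_all add: semidirect_product_def)

locale integer_semidirect_product =
  fixes H :: "('h, 'm) monoid_scheme" (structure) and n :: nat
    and \<phi> :: "'h \<Rightarrow> (nat \<Rightarrow> int) \<Rightarrow> (nat \<Rightarrow> int)"
    and A :: "nat set" and \<pi> :: "nat \<Rightarrow> 'h" and L :: "nat list set"
  assumes group_H: "group H" and n: "n > 0"
    and \<phi>: "\<phi> \<in> hom H (AutoGroup (int_power_group n))"
    and generators: "monoid_generators H A \<pi>"
    and str: "parallel_poly_pushdown_structure H A \<pi> L"
begin

sublocale H: group H by (rule group_H)

abbreviation "N \<equiv> int_power_group n"

sublocale N: group N by (rule group_int_power_group)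

abbreviation "G \<equiv> semidirect_product N H \<phi>"

lemma group_G: "group G"
  by (rule group_semidirect_product[OF N.group_axioms H.group_axioms \<phi>])

sublocale G: group G by (rule group_G)

lemma finite_A: "finite A" and \<pi>: "\<pi> \<in> A \<rightarrow> carrier H"
  using generators by (auto simp: monoid_generators_def)

lemma L_lists: "L \<subseteq> lists A"
  and L_bij: "bij_betw (word_value H \<pi>) L (carrier H)"
  and L_parallel: "parallel_poly_pushdown A L"
  using str by (simp_all add: parallel_poly_pushdown_structure_def)

lemma L_multiplier: "a \<in> A \<Longrightarrow> at_parallel_poly_pushdown A
    {(w, w'). w \<in> L \<and> w' \<in> L \<and> word_value H \<pi> w' = word_value H \<pi> (w @ [a])}"
  using str by (simp add: parallel_poly_pushdown_structure_def)

lemma word_value_L: "w \<in> L \<Longrightarrow> word_value H \<pi> w \<in> carrier H"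
  using H.word_value_closed[OF \<pi>] L_lists by blast

lemma aut: "h \<in> carrier H \<Longrightarrow> \<phi> h \<in> hom N N \<inter> Bij (carrier N)"
  using hom_in_carrier[OF \<phi>] by (simp add: AutoGroup_def auto_def)

lemma \<phi>_closed: "h \<in> carrier H \<Longrightarrow> x \<in> carrier N \<Longrightarrow> \<phi> h x \<in> carrier N"
  using aut by (auto simp: hom_def simp del: carrier_product_group)

lemma \<phi>_mult: "h \<in> carrier H \<Longrightarrow> x \<in> carrier N \<Longrightarrow> y \<in> carrier N \<Longrightarrow>
    \<phi> h (x \<otimes>\<^bsub>N\<^esub> y) = \<phi> h x \<otimes>\<^bsub>N\<^esub> \<phi> h y"
  using aut by (auto simp: hom_def simp del: carrier_product_group mult_product_group)

lemma \<phi>_bij: "h \<in> carrier H \<Longrightarrow> bij_betw (\<phi> h) (carrier N) (carrier N)"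
  using aut by (auto simp: Bij_def)

lemma \<phi>_eq_iff: "h \<in> carrier H \<Longrightarrow> x \<in> carrier N \<Longrightarrow> y \<in> carrier N \<Longrightarrow> \<phi> h x = \<phi> h y \<longleftrightarrow> x = y"
  using \<phi>_bij by (meson bij_betw_imp_inj_on inj_on_eq_iff)

lemma \<phi>_comp:
  assumes "h \<in> carrier H" "k \<in> carrier H" "x \<in> carrier N"
  shows "\<phi> (h \<otimes> k) x = \<phi> h (\<phi> k x)"
proof -
  have "\<phi> (h \<otimes> k) = \<phi> h \<otimes>\<^bsub>AutoGroup N\<^esub> \<phi> k"
    by (rule hom_mult[OF \<phi> assms(1,2)])
  also have "\<dots> = compose (carrier N) (\<phi> h) (\<phi> k)"
    using aut[OF assms(1)] aut[OF assms(2)] by (simp add: AutoGroup_def BijGroup_def)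
  finally show ?thesis using assms(3) by (simp only: compose_eq)
qed

lemma \<phi>_one: "x \<in> carrier N \<Longrightarrow> \<phi> \<one> x = x"
  using \<phi>_comp[of \<one> \<one> x] \<phi>_eq_iff[of \<one> "\<phi> \<one> x" x] \<phi>_closed[of \<one> x] by (simp del: carrier_product_group)

definition letter_value :: "nat \<Rightarrow> (nat \<Rightarrow> int) \<times> 'h" where
  "letter_value x = (case from_nat x of
     Old a \<Rightarrow> (\<one>\<^bsub>N\<^esub>, \<pi> a) | Mark \<Rightarrow> (\<one>\<^bsub>N\<^esub>, \<one>) | Gen i s \<Rightarrow> (unit_vector n i s, \<one>))"

lemma letter_value_simps [simp]:
  "letter_value (to_nat (Old a)) = (\<one>\<^bsub>N\<^esub>, \<pi> a)"
  "letter_value (to_nat Mark) = (\<one>\<^bsub>N\<^esub>, \<one>)"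
  "letter_value (to_nat (Gen i s)) = (unit_vector n i s, \<one>)"
  by (simp_all add: letter_value_def)

(* Vectors are treated as elements of the abstract group N from here on. *)
declare carrier_product_group [simp del] mult_product_group [simp del] one_product_group [simp del]

lemma letter_value_closed: "letter_value \<in> letters A n \<rightarrow> carrier G"
  using \<pi> by (auto elim!: letters_cases)

abbreviation "value_G \<equiv> word_value G letter_value"
abbreviation "value_H \<equiv> word_value H \<pi>"

lemma value_gens: "value_G (gens u) = (vector n u, \<one>)"
  by (induction u rule: gens.induct) (simp_all add: vector_Nil vector_Cons \<phi>_one)

lemma value_word: "w \<in> lists A \<Longrightarrow> value_G (word w u) = (\<phi> (value_H w) (vector n u), value_H w)"
proof (induction w)
  case Nil
  then show ?case by (simp add: word_def value_gens \<phi>_one)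
next
  case (Cons a w)
  then have "value_H w \<in> carrier H" "\<pi> a \<in> carrier H"
    using H.word_value_closed[OF \<pi>] \<pi> by (auto simp del: in_lists_conv_set)
  moreover have "value_G (word w u) = (\<phi> (value_H w) (vector n u), value_H w)"
    using Cons by simp
  moreover have "word (a # w) u = to_nat (Old a) # word w u" by (simp add: word_def)
  ultimately show ?case by (simp add: \<phi>_comp \<phi>_closed)
qed

definition language :: "nat list set" where
  "language = {word w u |w u. w \<in> L \<and> u \<in> lists ({..<n} \<times> UNIV) \<and> normal_form u}"

lemma language_iff: "p \<in> language \<longleftrightarrow> p \<in> normal_words A n \<and> (\<exists>w\<in>L. cuts_to old_letter p w)"
proof
  assume "p \<in> language"
  then obtain w u where w: "p = word w u" "w \<in> L" "u \<in> lists ({..<n} \<times> UNIV)" "normal_form u"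
    unfolding language_def by blast
  then have "cuts_to old_letter p w" by (simp only: cuts_to_word)
  moreover have "p \<in> normal_words A n" using w L_lists unfolding normal_words_def by blast
  ultimately show "p \<in> normal_words A n \<and> (\<exists>w\<in>L. cuts_to old_letter p w)" using w(2) by blast
next
  assume *: "p \<in> normal_words A n \<and> (\<exists>w\<in>L. cuts_to old_letter p w)"
  then obtain w u where w: "p = word w u" "u \<in> lists ({..<n} \<times> UNIV)" "normal_form u"
    unfolding normal_words_def by blast
  from * obtain w' where "w' \<in> L" "cuts_to old_letter p w'" by blast
  then have "w \<in> L" using w(1) by (simp only: cuts_to_word)
  then show "p \<in> language" using w unfolding language_def by blast
qed

lemma language_lists: "language \<subseteq> lists (letters A n)"
  using language_iff normal_words_letters by blast

lemma language_bij: "bij_betw value_G language (carrier G)"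
  unfolding bij_betw_def
proof
  show "inj_on value_G language"
  proof (rule inj_onI)
    fix p q assume "p \<in> language" "q \<in> language" and eq: "value_G p = value_G q"
    then obtain w u w' u' where p: "p = word w u" "w \<in> L" "u \<in> lists ({..<n} \<times> UNIV)" "normal_form u"
      and q: "q = word w' u'" "w' \<in> L" "u' \<in> lists ({..<n} \<times> UNIV)" "normal_form u'"
      unfolding language_def by blast
    have w: "w \<in> lists A" "w' \<in> lists A" using p q L_lists by blast+
    have "\<phi> (value_H w) (vector n u) = \<phi> (value_H w') (vector n u') \<and> value_H w = value_H w'"
      using eq unfolding p(1) q(1) value_word[OF w(1)] value_word[OF w(2)] prod.inject .
    then have eq: "\<phi> (value_H w) (vector n u) = \<phi> (value_H w') (vector n u')"
      "value_H w = value_H w'" by (rule conjunct1, rule conjunct2)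
    have "w = w'" by (rule inj_onD[OF bij_betw_imp_inj_on[OF L_bij] eq(2) p(2) q(2)])
    moreover have "\<phi> (value_H w) (vector n u) = \<phi> (value_H w) (vector n u')"
      using eq(1) unfolding eq(2) .
    then have "vector n u = vector n u'"
      using \<phi>_eq_iff[OF word_value_L[OF p(2)]] by simp
    then have "u = u'" by (rule vector_eqD[OF _ p(3) q(3) p(4) q(4)])
    ultimately show "p = q" using p q by simp
  qed
  show "value_G ` language = carrier G"
  proof (intro equalityI subsetI)
    fix g assume "g \<in> value_G ` language"
    then obtain p where "p \<in> language" "g = value_G p" by (elim imageE)
    then show "g \<in> carrier G"
      using G.word_value_closed[OF letter_value_closed subsetD[OF language_lists]] by simp
  next
    fix g assume "g \<in> carrier G"
    then obtain y h where g: "g = (y, h)" "y \<in> carrier N" "h \<in> carrier H"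
      unfolding semidirect_product_simps by (elim SigmaE)
    have "h \<in> value_H ` L" "y \<in> \<phi> h ` carrier N"
      unfolding bij_betw_imp_surj_on[OF L_bij] bij_betw_imp_surj_on[OF \<phi>_bij[OF g(3)]]
      by (fact g(3), fact g(2))
    then obtain w x where w: "w \<in> L" "h = value_H w" and x: "x \<in> carrier N" "y = \<phi> h x"
      by (elim imageE)
    obtain u where u: "u \<in> lists ({..<n} \<times> UNIV)" "normal_form u" "vector n u = x"
      using vector_surj[OF x(1)] .
    have "w \<in> lists A" using w(1) L_lists by blast
    then have "g = value_G (word w u)"
      unfolding g(1) x(2) u(3)[symmetric] w(2) by (rule value_word[symmetric])
    moreover have "word w u \<in> language" using w u unfolding language_def by blast
    ultimately show "g \<in> value_G ` language" by (rule image_eqI)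
  qed
qed

lemma language_parallel: "parallel_poly_pushdown (letters A n) language"
proof -
  have "parallel_poly_pushdown (letters A n)
      (normal_words A n \<inter> {p \<in> lists (letters A n). \<exists>w\<in>L. cuts_to old_letter p w})"
    by (rule parallel_poly_pushdown_Int
        [OF parallel_poly_pushdown_dpda[OF is_dpda_language_normal_words[OF finite_A]]
          parallel_poly_pushdown_prefix[OF L_parallel finite_letters[OF finite_A] old_letter_letters]])
  moreover have "normal_words A n \<inter> {p \<in> lists (letters A n). \<exists>w\<in>L. cuts_to old_letter p w} = language"
    using language_iff normal_words_letters[of A n] by blast
  ultimately show ?thesis by (simp only:)
qed

text \<open>
  Weights of letters, chosen such that the weight of a normal word for \<open>(\<phi>\<^sub>h y, h)\<close> is \<open>y\<^sub>j\<close> in the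
  first case and the \<open>j\<close>-th coordinate of \<open>\<phi>\<^sub>g y\<close> in the second one.
\<close>

definition coordinate :: "nat \<Rightarrow> nat \<Rightarrow> int" where
  "coordinate j x = (case from_nat x of Gen i s \<Rightarrow> if i = j then if s then 1 else -1 else 0 | _ \<Rightarrow> 0)"

definition image_coordinate :: "'h \<Rightarrow> nat \<Rightarrow> nat \<Rightarrow> int" where
  "image_coordinate g j x = (case from_nat x of Gen i s \<Rightarrow> \<phi> g (unit_vector n i s) j | _ \<Rightarrow> 0)"

lemma sum_coordinate: "sum_list (map (coordinate j) (word w u)) = signed j u"
proof -
  have "sum_list (map (coordinate j) (gens u)) = signed j u"
    by (induction u rule: gens.induct) (simp_all add: coordinate_def)
  moreover have "sum_list (map (coordinate j \<circ> (to_nat \<circ> Old)) w) = 0"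
    by (induction w) (simp_all add: coordinate_def)
  ultimately show ?thesis by (simp add: word_def) (simp add: coordinate_def)
qed

lemma sum_image_coordinate:
  assumes "g \<in> carrier H" "j < n"
  shows "sum_list (map (image_coordinate g j) (word w u)) = \<phi> g (vector n u) j"
proof -
  have "\<phi> g \<one>\<^bsub>N\<^esub> = \<one>\<^bsub>N\<^esub>"
    using aut[OF assms(1)] by (simp add: hom_one[OF _ N.group_axioms N.group_axioms])
  then have "sum_list (map (image_coordinate g j) (gens u)) = \<phi> g (vector n u) j"
    using assms
    by (induction u rule: gens.induct)
      (simp_all add: image_coordinate_def vector_Nil vector_Cons \<phi>_mult int_power_group_mult_apply
        one_product_group)
  moreover have "sum_list (map (image_coordinate g j \<circ> (to_nat \<circ> Old)) w) = 0"
    by (induction w) (simp_all add: image_coordinate_def)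
  ultimately show ?thesis by (simp add: word_def) (simp add: image_coordinate_def)
qed

text \<open>
  Let \<open>h\<close> and \<open>y\<close> be the values of the two parts of the first word.  The product is
  \<open>(\<phi>\<^sub>h (y + t), h g)\<close>.  If the first part of the second word has the value \<open>h g\<close> and its second
  part the value \<open>x\<close>, then the word has the value \<open>(\<phi>\<^bsub>h g\<^esub> x, h g)\<close>, where
  \<open>\<phi>\<^bsub>h g\<^esub> x = \<phi>\<^sub>h (\<phi>\<^sub>g x)\<close>, and the automorphism \<open>\<phi>\<^sub>h\<close> cancels.
\<close>

lemma multiplication_criterion:
  assumes "w \<in> L" "w' \<in> L" "t \<in> carrier N" "g \<in> carrier H"
  shows "value_G (word w' u') = value_G (word w u) \<otimes>\<^bsub>G\<^esub> (t, g) \<longleftrightarrow>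
    value_H w' = value_H w \<otimes> g \<and>
    (\<forall>j<n. t j + signed j u = \<phi> g (vector n u') j)"
proof -
  note h = word_value_L[OF assms(1)]
  have lists: "w \<in> lists A" "w' \<in> lists A" using assms L_lists by blast+
  have "value_G (word w u) \<otimes>\<^bsub>G\<^esub> (t, g) =
      (\<phi> (value_H w) (vector n u \<otimes>\<^bsub>N\<^esub> t), value_H w \<otimes> g)"
    using h assms by (simp add: value_word[OF lists(1)] \<phi>_mult)
  moreover have "\<phi> (value_H w \<otimes> g) (vector n u') = \<phi> (value_H w) (vector n u \<otimes>\<^bsub>N\<^esub> t) \<longleftrightarrow>
      \<phi> g (vector n u') = vector n u \<otimes>\<^bsub>N\<^esub> t"
    using h assms by (simp add: \<phi>_comp \<phi>_eq_iff \<phi>_closed)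
  moreover have "\<phi> g (vector n u') = vector n u \<otimes>\<^bsub>N\<^esub> t \<longleftrightarrow>
      (\<forall>j<n. t j + signed j u = \<phi> g (vector n u') j)"
  proof
    assume "\<phi> g (vector n u') = vector n u \<otimes>\<^bsub>N\<^esub> t"
    then show "\<forall>j<n. t j + signed j u = \<phi> g (vector n u') j"
      by (simp add: int_power_group_mult_apply vector_apply)
  next
    assume "\<forall>j<n. t j + signed j u = \<phi> g (vector n u') j"
    then show "\<phi> g (vector n u') = vector n u \<otimes>\<^bsub>N\<^esub> t"
      using assms
      by (intro int_power_group_eqI[of _ n])
        (simp_all add: \<phi>_closed int_power_group_mult_apply vector_apply add.commute)
  qed
  ultimately show ?thesis by (auto simp: value_word[OF lists(2)])
qed

text \<open>
  The relation is the intersection of the relation \<open>k = h g\<close> lifted to the prefixes, of the shape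
  condition on both words, and of one linear equation for each coordinate.
\<close>

lemma multiplier_language:
  assumes t: "t \<in> carrier N" and g: "g \<in> carrier H"
    and Q: "at_parallel_poly_pushdown A
      {(w, w'). w \<in> L \<and> w' \<in> L \<and> value_H w' = value_H w \<otimes> g}" (is "at_parallel_poly_pushdown A ?Q")
  shows "at_parallel_poly_pushdown (letters A n)
    {(p, q). p \<in> language \<and> q \<in> language \<and> value_G q = value_G p \<otimes>\<^bsub>G\<^esub> (t, g)}"
    (is "at_parallel_poly_pushdown _ ?R")
proof -
  let ?B = "lists (letters A n)"
  define W where "W = normal_words A n"
  define C where "C = {(p, q). p \<in> ?B \<and> q \<in> ?B \<and>
    (\<exists>(w, w')\<in>?Q. cuts_to old_letter p w \<and> cuts_to old_letter q w')}"
  define E where "E j = {(p, q). p \<in> ?B \<and> q \<in> ?B \<and>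
    t j + sum_list (map (coordinate j) p) = sum_list (map (image_coordinate g j) q)}" for j
  define D where "D = (\<Inter>j\<in>{..<n}. E j)"
  have E: "at_parallel_poly_pushdown (letters A n) (E j)" for j
    unfolding E_def
    by (rule at_parallel_poly_pushdown_two_tape
        [OF is_two_tape_language_linear[OF finite_letters[OF finite_A]]])
  have "{..<n} \<noteq> {}" using n by auto
  then have "at_parallel_poly_pushdown (letters A n) D"
    unfolding D_def by (rule at_parallel_poly_pushdown_INT[OF finite_lessThan _ E])
  moreover have "at_parallel_poly_pushdown (letters A n) C"
    unfolding C_def
    by (rule at_parallel_poly_pushdown_prefix[OF Q finite_letters[OF finite_A] old_letter_letters])
  moreover have "at_parallel_poly_pushdown (letters A n) (W \<times> W)"
    unfolding W_def
    by (rule at_parallel_poly_pushdown_two_tape[OF is_two_tape_language_normal_words[OF finite_A]])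
  ultimately have CWD: "at_parallel_poly_pushdown (letters A n) (C \<inter> W \<times> W \<inter> D)"
    by (intro at_parallel_poly_pushdown_Int)
  have mem: "x \<in> C \<inter> W \<times> W \<inter> D \<longleftrightarrow> x \<in> ?R" for x
  proof -
    obtain p q where x: "x = (p, q)" by (cases x)
    show ?thesis
    proof (cases "p \<in> W \<and> q \<in> W")
      case False
      then have "\<not> (p \<in> language \<and> q \<in> language)" using language_iff W_def by blast
      then show ?thesis using False x by auto
    next
      case True
      then obtain w u w' u' where p: "p = word w u" "w \<in> lists A" "u \<in> lists ({..<n} \<times> UNIV)" "normal_form u"
        and q: "q = word w' u'" "w' \<in> lists A" "u' \<in> lists ({..<n} \<times> UNIV)" "normal_form u'"
        unfolding normal_words_def W_def by blast
      have B: "p \<in> ?B" "q \<in> ?B" using True normal_words_letters[of A n] W_def by blast+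
      have C: "x \<in> C \<longleftrightarrow> w \<in> L \<and> w' \<in> L \<and> value_H w' = value_H w \<otimes> g"
        using B unfolding x C_def p(1) q(1) by (auto simp: cuts_to_word)
      have "x \<in> E j \<longleftrightarrow> t j + signed j u = \<phi> g (vector n u') j" if "j < n" for j
        using B that unfolding x E_def p(1) q(1)
        by (simp add: sum_coordinate sum_image_coordinate[OF g])
      then have D: "x \<in> D \<longleftrightarrow> (\<forall>j<n. t j + signed j u = \<phi> g (vector n u') j)"
        by (auto simp: D_def)
      have "p \<in> language \<longleftrightarrow> w \<in> L" "q \<in> language \<longleftrightarrow> w' \<in> L"
        using True unfolding language_iff p(1) q(1) cuts_to_word W_def by blast+
      then have "x \<in> ?R \<longleftrightarrow> w \<in> L \<and> w' \<in> L \<and> value_G q = value_G p \<otimes>\<^bsub>G\<^esub> (t, g)"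
        unfolding x by simp
      also have "\<dots> \<longleftrightarrow> w \<in> L \<and> w' \<in> L \<and> value_H w' = value_H w \<otimes> g \<and>
          (\<forall>j<n. t j + signed j u = \<phi> g (vector n u') j)"
        unfolding p(1) q(1) using multiplication_criterion[OF _ _ t g] by blast
      also have "\<dots> \<longleftrightarrow> x \<in> C \<and> x \<in> D" unfolding C D by (simp only: conj_assoc)
      finally show ?thesis using True x by simp
    qed
  qed
  have "C \<inter> W \<times> W \<inter> D = ?R" by (intro Set.set_eqI mem)
  with CWD show ?thesis by (simp only:)
qed

text \<open>
  Words of \<^term>\<open>L\<close> with the same value are equal, so that the relation is a diagonal.
\<close>

lemma trivial_multiplier:
  "at_parallel_poly_pushdown A {(w, w'). w \<in> L \<and> w' \<in> L \<and> value_H w' = value_H w \<otimes> \<one>}"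
proof -
  have "w \<in> L \<and> w' \<in> L \<and> value_H w' = value_H w \<otimes> \<one> \<longleftrightarrow> w \<in> L \<and> w = w'" for w w'
    using L_bij word_value_L by (metis H.r_one bij_betw_imp_inj_on inj_onD)
  then show ?thesis
    using at_parallel_poly_pushdown_diagonal[OF L_parallel L_lists finite_A] by simp
qed

lemma structure_G: "parallel_poly_pushdown_structure G (letters A n) letter_value language"
  unfolding parallel_poly_pushdown_structure_def
proof (intro conjI ballI language_lists language_bij language_parallel)
  fix x assume x: "x \<in> letters A n"
  have *: "at_parallel_poly_pushdown (letters A n)
      {(p, q). p \<in> language \<and> q \<in> language \<and> value_G q = value_G p \<otimes>\<^bsub>G\<^esub> letter_value x}"
    using x
  proof (cases rule: letters_cases)
    case (1 a)
    have "value_H (w @ [a]) = value_H w \<otimes> \<pi> a" if "w \<in> L" for w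
    proof -
      have "w \<in> lists A" "\<pi> a \<in> carrier H" using that L_lists 1 \<pi> by auto
      then show ?thesis using H.word_value_append[OF \<pi>, of w "[a]"] 1 by simp
    qed
    then have "w \<in> L \<and> w' \<in> L \<and> value_H w' = value_H (w @ [a]) \<longleftrightarrow>
        w \<in> L \<and> w' \<in> L \<and> value_H w' = value_H w \<otimes> \<pi> a" for w w'
      by auto
    then show ?thesis
      using L_multiplier[OF 1(1)] multiplier_language[of "\<one>\<^bsub>N\<^esub>" "\<pi> a"] \<pi> 1 by auto
  next
    case 2
    then show ?thesis using multiplier_language[OF _ _ trivial_multiplier] by simp
  next
    case (3 i s)
    then show ?thesis using multiplier_language[OF _ _ trivial_multiplier] by simp
  qed
  have "value_G (p @ [x]) = value_G p \<otimes>\<^bsub>G\<^esub> letter_value x" if "p \<in> language" for p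
    using G.word_value_append[OF letter_value_closed, of p "[x]"] that language_lists x
      funcset_mem[OF letter_value_closed x] by (auto simp del: semidirect_product_simps)
  then have "p \<in> language \<and> q \<in> language \<and> value_G q = value_G (p @ [x]) \<longleftrightarrow>
      p \<in> language \<and> q \<in> language \<and> value_G q = value_G p \<otimes>\<^bsub>G\<^esub> letter_value x" for p q
    by auto
  then show "at_parallel_poly_pushdown (letters A n)
      {(p, q). p \<in> language \<and> q \<in> language \<and> value_G q = value_G (p @ [x])}"
    using * by (simp only:)
qed

lemma generators_G: "monoid_generators G (letters A n) letter_value"
  unfolding monoid_generators_def
proof (intro conjI letter_value_closed finite_letters[OF finite_A])
  show "value_G ` lists (letters A n) = carrier G"
    using G.word_value_closed[OF letter_value_closed] language_bij language_lists
    unfolding bij_betw_def by blast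
qed

end

theorem theorem5p6:
  fixes H :: "('h, 'm) monoid_scheme"
    and n :: nat
    and \<phi> :: "'h \<Rightarrow> (nat \<Rightarrow> int) \<Rightarrow> (nat \<Rightarrow> int)"
  assumes "parallel_poly_pushdown_group H"
    and "n > 0"
    and "\<phi> \<in> hom H (AutoGroup (int_power_group n))"
  shows "parallel_poly_pushdown_group (semidirect_product (int_power_group n) H \<phi>)"
proof -
  from assms(1) obtain A :: "nat set" and \<pi> L where H: "group H" "monoid_generators H A \<pi>"
    "parallel_poly_pushdown_structure H A \<pi> L"
    unfolding parallel_poly_pushdown_group_def by blast
  interpret integer_semidirect_product H n \<phi> A \<pi> L
    by (rule integer_semidirect_product.intro[OF H(1) assms(2,3) H(2,3)])
  show ?thesis
    unfolding parallel_poly_pushdown_group_def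
    using group_G generators_G structure_G by blast
qed

end
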